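(* Let $M \geq 2$ and $N\geq 1$ be integers. The projective complex variety $\mathcal{B}_{M,N}$ has dimension $2MN - N + 4M - 6$.
   Context: Let $\mathbb{C}^{M\times M}_{\mathrm{sym}}$ and $\mathbb{C}^{M\times M}_{\mathrm{skew}}$ denote the spaces of symmetric and skew-symmetric complex $M\times M$ matrices. $\mathcal{B}_{M,N}$ is the subvariety of $\mathbb{P}(\mathbb{C}^{M\times N}\times\mathbb{C}^{M\times N})\times\mathbb{P}(\mathbb{C}^{M\times M}_{\mathrm{sym}}\times\mathbb{C}^{M\times M}_{\mathrm{skew}})$ consisting of the points $([U,V],[X,Y])$ for which $$\operatorname{rank}(X+\mathrm{i}Y)\leq 2 \quad\text{and}\quad u_n^TXu_n + v_n^TXv_n - 2u_n^TYv_n = 0 \ \text{ for all } 1\leq n\leq N,$$ where $u_n$ and $v_n$ are the $n$th columns of $U$ and $V$. Here $\mathbb{P}(W)$ is the projective space of lines in the complex vector space $W$, and dimension is the (Krull) dimension of a complex variety, i.e. the maximum of the dimensions of its irreducible components. *)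

theory Defs
  imports "HOL-Analysis.Analysis"
begin

section \<open>Krull dimension of a topological space\<close>

definition irreducible_closedin :: "'a topology \<Rightarrow> 'a set \<Rightarrow> bool" where
  "irreducible_closedin T Z \<longleftrightarrow> closedin T Z \<and> Z \<noteq> {} \<and>
     (\<forall>A B. closedin T A \<and> closedin T B \<and> Z = A \<union> B \<longrightarrow> Z = A \<or> Z = B)"

text \<open>Supremum of the lengths \<open>n\<close> of chains \<open>Z 0 \<subset> \<dots> \<subset> Z n\<close> of irreducible closed subsets;
  the empty space has dimension \<open>-\<infinity>\<close>.\<close>

definition krull_dim :: "'a topology \<Rightarrow> ereal" where
  "krull_dim T = Sup {ereal (real n) | n.
     \<exists>Z. (\<forall>i\<le>n. irreducible_closedin T (Z i)) \<and> (\<forall>i<n. Z i \<subset> Z (Suc i))}"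


section \<open>The Zariski topology on a product of two projective spaces\<close>

text \<open>Scalar multiplications are explicit parameters, since the library has no type class of
  complex vector spaces. A point of a projective space is a line, as a set of vectors that
  includes the origin.\<close>

definition proj_space :: "(complex \<Rightarrow> 'v \<Rightarrow> 'v) \<Rightarrow> 'v::ab_group_add set \<Rightarrow> 'v set set" where
  "proj_space s W = {module.span s {w} | w. w \<in> W \<and> w \<noteq> 0}"

inductive complex_poly_fun :: "(complex \<Rightarrow> 'v \<Rightarrow> 'v) \<Rightarrow> ('v::ab_group_add \<Rightarrow> complex) \<Rightarrow> bool"
  for s where
  linear: "Vector_Spaces.linear s (*) f \<Longrightarrow> complex_poly_fun s f"
| const: "complex_poly_fun s (\<lambda>x. c)"
| add: "complex_poly_fun s f \<Longrightarrow> complex_poly_fun s g \<Longrightarrow> complex_poly_fun s (\<lambda>x. f x + g x)"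
| mult: "complex_poly_fun s f \<Longrightarrow> complex_poly_fun s g \<Longrightarrow> complex_poly_fun s (\<lambda>x. f x * g x)"

definition bihomogeneous ::
  "(complex \<Rightarrow> 'v \<Rightarrow> 'v) \<Rightarrow> (complex \<Rightarrow> 'w \<Rightarrow> 'w) \<Rightarrow> ('v::ab_group_add \<times> 'w::ab_group_add \<Rightarrow> complex) \<Rightarrow> bool"
  where
  "bihomogeneous s1 s2 f \<longleftrightarrow> complex_poly_fun (module_prod.scale s1 s2) f \<and>
     (\<exists>d e. \<forall>a b v w. f (s1 a v, s2 b w) = a ^ d * b ^ e * f (v, w))"

text \<open>By bihomogeneity, \<open>f\<close> vanishes at all pairs of vectors of two lines as soon as it vanishes at
  one pair of nonzero ones.\<close>

definition bizero_locus ::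
  "(complex \<Rightarrow> 'v \<Rightarrow> 'v) \<Rightarrow> (complex \<Rightarrow> 'w \<Rightarrow> 'w) \<Rightarrow> 'v::ab_group_add set \<Rightarrow> 'w::ab_group_add set \<Rightarrow>
   ('v \<times> 'w \<Rightarrow> complex) set \<Rightarrow> ('v set \<times> 'w set) set" where
  "bizero_locus s1 s2 W1 W2 F =
     {(p, q) \<in> proj_space s1 W1 \<times> proj_space s2 W2. \<forall>f\<in>F. \<forall>v\<in>p. \<forall>w\<in>q. f (v, w) = 0}"

text \<open>The polynomials live on the ambient spaces and are only evaluated on the subspaces \<open>W1\<close>
  and \<open>W2\<close>; nothing is lost, as a homogeneous polynomial on a subspace extends.\<close>

definition zariski_open ::
  "(complex \<Rightarrow> 'v \<Rightarrow> 'v) \<Rightarrow> (complex \<Rightarrow> 'w \<Rightarrow> 'w) \<Rightarrow> 'v::ab_group_add set \<Rightarrow> 'w::ab_group_add set \<Rightarrow>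
   ('v set \<times> 'w set) set \<Rightarrow> bool" where
  "zariski_open s1 s2 W1 W2 S \<longleftrightarrow> (\<exists>F. (\<forall>f\<in>F. bihomogeneous s1 s2 f) \<and>
     S = proj_space s1 W1 \<times> proj_space s2 W2 - bizero_locus s1 s2 W1 W2 F)"

definition zariski_topology ::
  "(complex \<Rightarrow> 'v \<Rightarrow> 'v) \<Rightarrow> (complex \<Rightarrow> 'w \<Rightarrow> 'w) \<Rightarrow> 'v::ab_group_add set \<Rightarrow> 'w::ab_group_add set \<Rightarrow>
   ('v set \<times> 'w set) topology" where
  "zariski_topology s1 s2 W1 W2 = topology (zariski_open s1 s2 W1 W2)"

lemma bihomogeneous_mult:
  assumes "bihomogeneous s1 s2 f" "bihomogeneous s1 s2 g"
  shows "bihomogeneous s1 s2 (\<lambda>x. f x * g x)"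
proof -
  obtain d e d' e' where
    "\<And>a b v w. f (s1 a v, s2 b w) = a ^ d * b ^ e * f (v, w)"
    "\<And>a b v w. g (s1 a v, s2 b w) = a ^ d' * b ^ e' * g (v, w)"
    using assms unfolding bihomogeneous_def by metis
  then have "f (s1 a v, s2 b w) * g (s1 a v, s2 b w)
      = a ^ (d + d') * b ^ (e + e') * (f (v, w) * g (v, w))" for a b v w
    by (simp add: power_add)
  then show ?thesis
    using assms unfolding bihomogeneous_def
    by (intro conjI exI[of _ "d + d'"] exI[of _ "e + e'"] complex_poly_fun.mult) auto
qed

lemma bihomogeneous_one: "bihomogeneous s1 s2 (\<lambda>x. 1)"
  unfolding bihomogeneous_def
  by (intro conjI exI[of _ 0] complex_poly_fun.const) simp

lemma bizero_locus_span_iff: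
  assumes "vector_space s1" "vector_space s2"
    and "v \<in> W1" "v \<noteq> 0" "w \<in> W2" "w \<noteq> 0" and F: "\<forall>f\<in>F. bihomogeneous s1 s2 f"
  shows "(module.span s1 {v}, module.span s2 {w}) \<in> bizero_locus s1 s2 W1 W2 F
    \<longleftrightarrow> (\<forall>f\<in>F. f (v, w) = 0)"
proof -
  interpret V: vector_space s1 by fact
  interpret W: vector_space s2 by fact
  have "(\<forall>x\<in>V.span {v}. \<forall>y\<in>W.span {w}. f (x, y) = 0) \<longleftrightarrow> f (v, w) = 0" if f: "f \<in> F" for f
  proof
    assume "f (v, w) = 0"
    moreover obtain d e where "\<And>a b v w. f (s1 a v, s2 b w) = a ^ d * b ^ e * f (v, w)"
      using F f unfolding bihomogeneous_def by metis
    ultimately show "\<forall>x\<in>V.span {v}. \<forall>y\<in>W.span {w}. f (x, y) = 0"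
      by (auto simp: V.span_singleton W.span_singleton)
  qed (auto intro: V.span_base W.span_base)
  moreover have "(V.span {v}, W.span {w}) \<in> proj_space s1 W1 \<times> proj_space s2 W2"
    using assms by (auto simp: proj_space_def)
  ultimately show ?thesis
    by (auto simp: bizero_locus_def)
qed

lemma istopology_zariski_open:
  assumes "vector_space s1" "vector_space s2"
  shows "istopology (zariski_open s1 s2 W1 W2)"
  unfolding istopology_def
proof (intro conjI allI impI)
  let ?P = "proj_space s1 W1 \<times> proj_space s2 W2"
  let ?V = "bizero_locus s1 s2 W1 W2"
  fix S T
  assume "zariski_open s1 s2 W1 W2 S" "zariski_open s1 s2 W1 W2 T"
  then obtain F G where
    F: "\<forall>f\<in>F. bihomogeneous s1 s2 f" "S = ?P - ?V F" and
    G: "\<forall>g\<in>G. bihomogeneous s1 s2 g" "T = ?P - ?V G"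
    unfolding zariski_open_def by blast
  define H where "H = {\<lambda>x. f x * g x | f g. f \<in> F \<and> g \<in> G}"
  have H: "\<forall>h\<in>H. bihomogeneous s1 s2 h"
    unfolding H_def using F(1) G(1) bihomogeneous_mult by blast
  have "pq \<in> ?V H \<longleftrightarrow> pq \<in> ?V F \<or> pq \<in> ?V G" if P: "pq \<in> ?P" for pq
  proof -
    obtain v w where vw: "pq = (module.span s1 {v}, module.span s2 {w})"
      "v \<in> W1" "v \<noteq> 0" "w \<in> W2" "w \<noteq> 0"
      using P unfolding proj_space_def by blast
    have "(\<forall>h\<in>H. h (v, w) = 0) \<longleftrightarrow> (\<forall>f\<in>F. \<forall>g\<in>G. f (v, w) * g (v, w) = 0)"
      unfolding H_def by fast
    also have "\<dots> \<longleftrightarrow> (\<forall>f\<in>F. f (v, w) = 0) \<or> (\<forall>g\<in>G. g (v, w) = 0)"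
      by auto
    finally show ?thesis
      using bizero_locus_span_iff[OF assms vw(2-5)] F(1) G(1) H vw(1) by simp
  qed
  then have "S \<inter> T = ?P - ?V H"
    using F(2) G(2) by blast
  with H show "zariski_open s1 s2 W1 W2 (S \<inter> T)"
    unfolding zariski_open_def by blast
next
  let ?P = "proj_space s1 W1 \<times> proj_space s2 W2"
  let ?V = "bizero_locus s1 s2 W1 W2"
  fix K
  assume "\<forall>S\<in>K. zariski_open s1 s2 W1 W2 S"
  then have "\<exists>F. \<forall>S\<in>K. (\<forall>f\<in>F S. bihomogeneous s1 s2 f) \<and> S = ?P - ?V (F S)"
    unfolding zariski_open_def by (intro bchoice)
  then obtain F where F: "\<And>S. S \<in> K \<Longrightarrow> (\<forall>f\<in>F S. bihomogeneous s1 s2 f) \<and> S = ?P - ?V (F S)"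
    by blast
  have "\<Union>K = (\<Union>S\<in>K. ?P - ?V (F S))"
    using F by blast
  also have "\<dots> = ?P - ?V (\<Union>S\<in>K. F S)"
    by (auto simp: bizero_locus_def)
  finally have "\<Union>K = ?P - ?V (\<Union>S\<in>K. F S)" .
  with F show "zariski_open s1 s2 W1 W2 (\<Union>K)"
    unfolding zariski_open_def by (intro exI[of _ "\<Union>S\<in>K. F S"]) blast
qed

lemma topspace_zariski_topology:
  assumes "vector_space s1" "vector_space s2"
  shows "topspace (zariski_topology s1 s2 W1 W2) = proj_space s1 W1 \<times> proj_space s2 W2"
proof -
  let ?P = "proj_space s1 W1 \<times> proj_space s2 W2"
  have "w \<in> module.span s1 {w}" "w' \<in> module.span s2 {w'}" for w w'
    using assms by (simp_all add: module.span_base module_iff_vector_space)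
  then have "bizero_locus s1 s2 W1 W2 {\<lambda>x. 1} = {}"
    by (fastforce simp: bizero_locus_def proj_space_def)
  then have "zariski_open s1 s2 W1 W2 ?P"
    unfolding zariski_open_def by (intro exI[of _ "{\<lambda>x. 1}"]) (simp add: bihomogeneous_one)
  moreover have "S \<subseteq> ?P" if "zariski_open s1 s2 W1 W2 S" for S
    using that by (auto simp: zariski_open_def)
  ultimately show ?thesis
    using istopology_zariski_open[OF assms]
    by (auto simp: zariski_topology_def topspace_def)
qed

lemma closedin_zariski_topology:
  assumes "vector_space s1" "vector_space s2"
  shows "closedin (zariski_topology s1 s2 W1 W2) Z \<longleftrightarrow>
    (\<exists>F. (\<forall>f\<in>F. bihomogeneous s1 s2 f) \<and> Z = bizero_locus s1 s2 W1 W2 F)"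
proof -
  let ?P = "proj_space s1 W1 \<times> proj_space s2 W2"
  have "openin (zariski_topology s1 s2 W1 W2) S \<longleftrightarrow> zariski_open s1 s2 W1 W2 S" for S
    using istopology_zariski_open[OF assms] by (simp add: zariski_topology_def)
  moreover have "bizero_locus s1 s2 W1 W2 F \<subseteq> ?P" for F
    by (auto simp: bizero_locus_def)
  ultimately have "closedin (zariski_topology s1 s2 W1 W2) Z \<longleftrightarrow>
    (\<exists>F. (\<forall>f\<in>F. bihomogeneous s1 s2 f) \<and> Z \<subseteq> ?P \<and> ?P - Z = ?P - bizero_locus s1 s2 W1 W2 F)"
    unfolding closedin_def topspace_zariski_topology[OF assms] zariski_open_def by meson
  moreover have "Z \<subseteq> ?P \<and> ?P - Z = ?P - Y \<longleftrightarrow> Z = Y" if "Y \<subseteq> ?P" for Y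
    using that by blast
  ultimately show ?thesis
    using \<open>\<And>F. bizero_locus s1 s2 W1 W2 F \<subseteq> ?P\<close> by presburger
qed


section \<open>The variety\<close>

definition cmat_scale :: "complex \<Rightarrow> complex^'n^'m \<Rightarrow> complex^'n^'m" where
  "cmat_scale c A = (\<chi> i j. c * A $ i $ j)"

definition cmat_pair_scale ::
  "complex \<Rightarrow> (complex^'n^'m) \<times> (complex^'n^'m) \<Rightarrow> (complex^'n^'m) \<times> (complex^'n^'m)" where
  "cmat_pair_scale = module_prod.scale cmat_scale cmat_scale"

lemma vector_space_cmat_scale: "vector_space cmat_scale"
  by unfold_locales (simp_all add: cmat_scale_def vec_eq_iff algebra_simps)

lemma vector_space_cmat_pair_scale: "vector_space cmat_pair_scale"
proof -
  interpret vector_space_prod cmat_scale cmat_scale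
    by (intro vector_space_prod.intro vector_space_pair.intro vector_space_cmat_scale)
  show ?thesis
    unfolding cmat_pair_scale_def by unfold_locales
qed

definition sym_skew_pairs :: "((complex^'m^'m) \<times> (complex^'m^'m)) set" where
  "sym_skew_pairs = {(X, Y). transpose X = X \<and> transpose Y = - Y}"

text \<open>\<open>x\<^sup>T A y\<close>, without complex conjugation\<close>

definition bilin :: "complex^'m \<Rightarrow> complex^'m^'m \<Rightarrow> complex^'m \<Rightarrow> complex" where
  "bilin x A y = (\<Sum>i\<in>UNIV. \<Sum>j\<in>UNIV. x $ i * A $ i $ j * y $ j)"

definition B_cond ::
  "(complex^'n^'m) \<times> (complex^'n^'m) \<Rightarrow> (complex^'m^'m) \<times> (complex^'m^'m) \<Rightarrow> bool" where
  "B_cond = (\<lambda>(U, V) (X, Y). rank (X + cmat_scale \<i> Y) \<le> 2 \<and>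
     (\<forall>n. bilin (column n U) X (column n U) + bilin (column n V) X (column n V)
        - 2 * bilin (column n U) Y (column n V) = 0))"

definition BB_topology ::
  "(((complex^'n^'m) \<times> (complex^'n^'m)) set \<times> ((complex^'m^'m) \<times> (complex^'m^'m)) set) topology" where
  "BB_topology = zariski_topology cmat_pair_scale cmat_pair_scale UNIV sym_skew_pairs"

text \<open>\<open>M = CARD('m)\<close> and \<open>N = CARD('n)\<close>. The conditions are homogeneous in \<open>P\<close> and in \<open>Q\<close>, so they do
  not depend on the representatives of the two lines.\<close>

definition BB ::
  "(((complex^'n^'m) \<times> (complex^'n^'m)) set \<times> ((complex^'m^'m) \<times> (complex^'m^'m)) set) set" where
  "BB = {(module.span cmat_pair_scale {P}, module.span cmat_pair_scale {Q}) | P Q.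
     P \<noteq> 0 \<and> Q \<in> sym_skew_pairs \<and> Q \<noteq> 0 \<and> B_cond P Q}"

end

theory Submission
  imports Defs "HOL-Library.Function_Algebras"
begin

text \<open>
  Put \<open>Z = X + \<i>Y\<close>, an arbitrary square matrix, and \<open>a\<^sub>n = u\<^sub>n - \<i>v\<^sub>n\<close>, \<open>b\<^sub>n = u\<^sub>n + \<i>v\<^sub>n\<close>; then the equations
  become \<open>a\<^sub>n\<^sup>T Z b\<^sub>n = 0\<close>.

  Upper bound. A chain of irreducible closed sets of length \<open>n\<close> yields bihomogeneous polynomials
  \<open>g 0, \<dots>, g n\<close>, each vanishing on the previous member of the chain but not on its own, such that
  the products of degree \<open>d\<close> span a space of dimension at least \<open>(d + n) choose n\<close> of functions on the
  last member. On the other hand, up to scaling, the variety is covered by finitely many sets on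
  which all coordinates are rational functions of \<open>D = 2MN - N + 4M - 6\<close> of them: a matrix of rank two
  is determined by two rows and two columns, and each equation can be solved for a coordinate of
  \<open>a\<^sub>n\<close> or \<open>b\<^sub>n\<close>. So that dimension grows at most like \<open>d\<^sup>D\<close>, and \<open>n \<le> D\<close>.

  Lower bound. The variety contains the image of a polynomial map on \<open>D\<close>-dimensional affine space. The
  closures of the images of a flag of coordinate subspaces are irreducible, and successive ones are
  separated by a linear coordinate, since the parameters can be recovered as coordinates one by one.
\<close>

section \<open>Growth of spaces of functions\<close>

definition fun_scale :: "complex \<Rightarrow> ('a \<Rightarrow> complex) \<Rightarrow> 'a \<Rightarrow> complex" where
  "fun_scale c f = (\<lambda>x. c * f x)"

global_interpretation fun_space: vector_space fun_scale
  by unfold_locales (auto simp: fun_scale_def fun_eq_iff algebra_simps)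

lemma fun_scale_apply: "fun_scale c f x = c * f x"
  by (simp add: fun_scale_def)

lemma sum_fun_apply: "(\<Sum>i\<in>I. f i) x = (\<Sum>i\<in>I. f i x :: complex)"
  by (induction I rule: infinite_finite_induct) auto

lemma sum_lessThan_add: "(\<Sum>i<a + b. h i) = (\<Sum>i<a. h i) + (\<Sum>i<b::nat. h (a + i) :: complex)"
  by (induction b) (auto simp: add.assoc)

text \<open>An indexed family rather than a set, so that two members agreeing on \<open>X\<close>
  count as dependent.\<close>

definition indep_on :: "'a set \<Rightarrow> nat \<Rightarrow> (nat \<Rightarrow> 'a \<Rightarrow> complex) \<Rightarrow> bool" where
  "indep_on X N f \<longleftrightarrow>
     (\<forall>c. (\<forall>x\<in>X. (\<Sum>i<N. c i * f i x) = 0) \<longrightarrow> (\<forall>i<N. c i = 0))"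

text \<open>A linear relation among extensions of the \<open>f i\<close> restricts to a relation on
  \<open>X\<close>. So the extensions, wherever they come from, are distinct and independent vectors
  in the span of \<open>W\<close>.\<close>

lemma indep_on_le_card:
  assumes ind: "indep_on X N f" and W: "finite W"
    and f: "\<And>i. i < N \<Longrightarrow> \<exists>q\<in>fun_space.span W. \<forall>x\<in>X. q x = f i x"
  shows "N \<le> card W"
proof -
  obtain q where q: "\<And>i. i < N \<Longrightarrow> q i \<in> fun_space.span W"
    and qf: "\<And>i x. i < N \<Longrightarrow> x \<in> X \<Longrightarrow> q i x = f i x"
    using f by metis
  have inj: "inj_on q {..<N}"
  proof (rule inj_onI, rule ccontr)
    fix i j assume ij: "i \<in> {..<N}" "j \<in> {..<N}" "q i = q j" "i \<noteq> j"
    define c :: "nat \<Rightarrow> complex" where "c = (\<lambda>k. if k = i then 1 else if k = j then - 1 else 0)"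
    have "(\<Sum>k<N. c k * f k x) = 0" if "x \<in> X" for x
    proof -
      have "(\<Sum>k<N. c k * f k x) = (\<Sum>k\<in>{i, j}. c k * f k x)"
        using ij by (intro sum.mono_neutral_right) (auto simp: c_def)
      also have "\<dots> = 0"
        using ij qf[of i x] qf[of j x] that by (simp add: c_def)
      finally show ?thesis .
    qed
    then have "c i = 0"
      using ind ij(1) unfolding indep_on_def by blast
    then show False
      by (simp add: c_def)
  qed
  have "fun_space.independent (q ` {..<N})"
  proof (rule fun_space.independent_if_scalars_zero)
    fix u w
    assume sum0: "(\<Sum>w\<in>q ` {..<N}. fun_scale (u w) w) = 0" and w: "w \<in> q ` {..<N}"
    have "(\<Sum>i<N. u (q i) * f i x) = 0" if "x \<in> X" for x
    proof -
      have "0 = (\<Sum>w\<in>q ` {..<N}. fun_scale (u w) w) x"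
        using sum0 by simp
      also have "\<dots> = (\<Sum>i<N. u (q i) * q i x)"
        by (simp add: sum_fun_apply fun_scale_apply sum.reindex[OF inj])
      also have "\<dots> = (\<Sum>i<N. u (q i) * f i x)"
        using qf that by simp
      finally show ?thesis by simp
    qed
    then have "\<forall>i<N. u (q i) = 0"
      using ind unfolding indep_on_def by (elim allE[of _ "\<lambda>i. u (q i)"]) blast
    then show "u w = 0"
      using w by auto
  qed simp
  then have "card (q ` {..<N}) \<le> card W"
    using fun_space.independent_span_bound[OF W] q by (auto simp: image_subset_iff)
  then show ?thesis
    by (simp add: card_image[OF inj])
qed

fun prods :: "('a \<Rightarrow> complex) set \<Rightarrow> nat \<Rightarrow> ('a \<Rightarrow> complex) set" where
  "prods G 0 = {\<lambda>x. 1}"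
| "prods G (Suc d) = {\<lambda>x. g x * p x | g p. g \<in> G \<and> p \<in> prods G d}"

text \<open>Plays the role of "transcendence degree at most \<open>D\<close>": a Hilbert function
  bound, uniform in \<open>d\<close> for each finite \<open>G\<close>. As the spanning functions are
  arbitrary, the bound survives finite unions and division by nonvanishing functions.\<close>

definition growth_le :: "nat \<Rightarrow> ('a \<Rightarrow> complex) set \<Rightarrow> 'a set \<Rightarrow> bool" where
  "growth_le D R X \<longleftrightarrow> (\<forall>G. finite G \<and> G \<subseteq> R \<longrightarrow>
     (\<exists>K. \<forall>d. \<exists>W. finite W \<and> card W \<le> K * Suc d ^ D \<and>
        (\<forall>p\<in>prods G d. \<exists>q\<in>fun_space.span W. \<forall>x\<in>X. q x = p x)))"

lemma span_mult:
  assumes "q \<in> fun_space.span W"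
  shows "(\<lambda>x. h x * q x) \<in> fun_space.span ((\<lambda>w x. h x * w x) ` W)"
  using assms
proof (induction rule: fun_space.span_induct_alt)
  case base
  have "(\<lambda>x. h x * 0 x) = (0 :: 'a \<Rightarrow> complex)"
    by (simp add: fun_eq_iff)
  then show ?case
    using fun_space.span_zero by simp
next
  case (step c w y)
  have "(\<lambda>x. h x * (fun_scale c w + y) x)
      = fun_scale c (\<lambda>x. h x * w x) + (\<lambda>x. h x * y x)"
    by (simp add: fun_eq_iff fun_scale_apply algebra_simps)
  then show ?case
    using step by (simp add: fun_space.span_add fun_space.span_scale fun_space.span_base)
qed

text \<open>Spanning functions for \<open>X\<close>, cut off by the indicator of \<open>X\<close>,
  and those for \<open>Y\<close>, cut off by that of the complement of \<open>X\<close>, together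
  span on the union. The constants add.\<close>

lemma growth_le_Un:
  assumes X: "growth_le D R X" and Y: "growth_le D R Y"
  shows "growth_le D R (X \<union> Y)"
  unfolding growth_le_def
proof (intro allI impI, elim conjE)
  fix G assume G: "finite G" "G \<subseteq> R"
  obtain K where K: "\<And>d. \<exists>W. finite W \<and> card W \<le> K * Suc d ^ D \<and>
      (\<forall>p\<in>prods G d. \<exists>q\<in>fun_space.span W. \<forall>x\<in>X. q x = p x)"
    using X G unfolding growth_le_def by meson
  obtain L where L: "\<And>d. \<exists>W. finite W \<and> card W \<le> L * Suc d ^ D \<and>
      (\<forall>p\<in>prods G d. \<exists>q\<in>fun_space.span W. \<forall>x\<in>Y. q x = p x)"
    using Y G unfolding growth_le_def by meson
  have "\<exists>W. finite W \<and> card W \<le> (K + L) * Suc d ^ D \<and>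
      (\<forall>p\<in>prods G d. \<exists>q\<in>fun_space.span W. \<forall>x\<in>X \<union> Y. q x = p x)" for d
  proof -
    obtain W1 where W1: "finite W1" "card W1 \<le> K * Suc d ^ D"
      "\<And>p. p \<in> prods G d \<Longrightarrow> \<exists>q\<in>fun_space.span W1. \<forall>x\<in>X. q x = p x"
      using K by meson
    obtain W2 where W2: "finite W2" "card W2 \<le> L * Suc d ^ D"
      "\<And>p. p \<in> prods G d \<Longrightarrow> \<exists>q\<in>fun_space.span W2. \<forall>x\<in>Y. q x = p x"
      using L by meson
    define V1 where "V1 = (\<lambda>w x. indicator X x * w x) ` W1"
    define V2 where "V2 = (\<lambda>w x. indicator (- X) x * w x) ` W2"
    have "card (V1 \<union> V2) \<le> card W1 + card W2"
      unfolding V1_def V2_def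
      by (intro order_trans[OF card_Un_le] add_mono card_image_le W1(1) W2(1))
    then have "card (V1 \<union> V2) \<le> (K + L) * Suc d ^ D"
      using W1(2) W2(2) by (simp add: algebra_simps)
    moreover have "\<exists>q\<in>fun_space.span (V1 \<union> V2). \<forall>x\<in>X \<union> Y. q x = p x" if p: "p \<in> prods G d" for p
    proof -
      obtain q1 where q1: "q1 \<in> fun_space.span W1" "\<And>x. x \<in> X \<Longrightarrow> q1 x = p x"
        using W1(3)[OF p] by blast
      obtain q2 where q2: "q2 \<in> fun_space.span W2" "\<And>x. x \<in> Y \<Longrightarrow> q2 x = p x"
        using W2(3)[OF p] by blast
      define q where "q = (\<lambda>x. indicator X x * q1 x) + (\<lambda>x. indicator (- X) x * q2 x)"
      have "q \<in> fun_space.span (V1 \<union> V2)"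
        unfolding q_def V1_def V2_def
        by (intro fun_space.span_add fun_space.span_mono[OF Un_upper1, THEN subsetD]
            fun_space.span_mono[OF Un_upper2, THEN subsetD] span_mult q1(1) q2(1))
      moreover have "\<forall>x\<in>X \<union> Y. q x = p x"
        using q1(2) q2(2) by (auto simp: q_def indicator_def)
      ultimately show ?thesis by blast
    qed
    moreover have "finite (V1 \<union> V2)"
      using W1(1) W2(1) by (simp add: V1_def V2_def)
    ultimately show ?thesis by blast
  qed
  then show "\<exists>K. \<forall>d. \<exists>W. finite W \<and> card W \<le> K * Suc d ^ D \<and>
      (\<forall>p\<in>prods G d. \<exists>q\<in>fun_space.span W. \<forall>x\<in>X \<union> Y. q x = p x)"
    by blast
qed

lemma growth_le_empty: "growth_le D R {}"
  unfolding growth_le_def using fun_space.span_zero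
  by (intro allI impI exI[of _ 0] exI[of _ "{}"]) auto

lemma growth_le_UN:
  assumes "finite I" "\<And>i. i \<in> I \<Longrightarrow> growth_le D R (X i)"
  shows "growth_le D R (\<Union>i\<in>I. X i)"
  using assms by (induction I) (auto intro: growth_le_empty growth_le_Un)


section \<open>Rational functions in finitely many given functions\<close>

text \<open>Each exponent is bounded separately, rather than the total degree. The count is then at
  most \<open>Suc k ^ card T\<close>, and the bounds add under multiplication.\<close>

definition monomials :: "('a \<Rightarrow> complex) set \<Rightarrow> nat \<Rightarrow> ('a \<Rightarrow> complex) set" where
  "monomials T k = (\<lambda>e x. \<Prod>t\<in>T. t x ^ e t) ` (T \<rightarrow>\<^sub>E {..k})"

definition boxpoly :: "('a \<Rightarrow> complex) set \<Rightarrow> nat \<Rightarrow> ('a \<Rightarrow> complex) set" where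
  "boxpoly T k = fun_space.span (monomials T k)"

lemma finite_monomials: "finite T \<Longrightarrow> finite (monomials T k)"
  by (simp add: monomials_def finite_PiE)

lemma card_monomials_le:
  assumes "finite T"
  shows "card (monomials T k) \<le> Suc k ^ card T"
proof -
  have "card (monomials T k) \<le> card (T \<rightarrow>\<^sub>E {..k})"
    unfolding monomials_def by (intro card_image_le finite_PiE assms) simp
  then show ?thesis
    by (simp add: card_PiE assms)
qed

lemma monomialsI: "(\<And>t. t \<in> T \<Longrightarrow> e t \<le> k) \<Longrightarrow> (\<lambda>x. \<Prod>t\<in>T. t x ^ e t) \<in> monomials T k"
  unfolding monomials_def
  by (rule image_eqI[of _ _ "restrict e T"]) (auto simp: fun_eq_iff intro!: prod.cong)

lemma monomialsD:
  assumes "m \<in> monomials T k"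
  shows "\<exists>e. (\<forall>t\<in>T. e t \<le> k) \<and> m = (\<lambda>x. \<Prod>t\<in>T. t x ^ e t)"
  using assms unfolding monomials_def by (auto simp: PiE_def Pi_def)

lemma boxpoly_mono: "k \<le> l \<Longrightarrow> boxpoly T k \<subseteq> boxpoly T l"
  unfolding boxpoly_def
  by (intro fun_space.span_mono subsetI) (auto dest!: monomialsD intro!: monomialsI intro: order_trans)

lemma boxpoly_const: "(\<lambda>x. c) \<in> boxpoly T k"
proof -
  have "(\<lambda>x. 1) \<in> monomials T k"
    using monomialsI[of T "\<lambda>_. 0" k] by simp
  then have "fun_scale c (\<lambda>x. 1) \<in> boxpoly T k"
    unfolding boxpoly_def by (intro fun_space.span_scale fun_space.span_base)
  then show ?thesis
    by (simp add: fun_scale_def)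
qed

lemma boxpoly_gen:
  assumes "finite T" "t \<in> T"
  shows "t \<in> boxpoly T (Suc k)"
proof -
  have "(\<lambda>x. \<Prod>s\<in>T. s x ^ (if s = t then 1 else 0)) = t"
    using assms by (intro ext) (simp add: prod.remove)
  moreover have "(\<lambda>x. \<Prod>s\<in>T. s x ^ (if s = t then 1 else 0)) \<in> monomials T (Suc k)"
    by (rule monomialsI) auto
  ultimately show ?thesis
    unfolding boxpoly_def by (metis fun_space.span_base)
qed

lemma boxpoly_add: "p \<in> boxpoly T k \<Longrightarrow> q \<in> boxpoly T k \<Longrightarrow> (\<lambda>x. p x + q x) \<in> boxpoly T k"
  unfolding boxpoly_def using fun_space.span_add[of p _ q] by (simp add: plus_fun_def)

lemma boxpoly_mult:
  assumes "p \<in> boxpoly T k" "q \<in> boxpoly T l"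
  shows "(\<lambda>x. p x * q x) \<in> boxpoly T (k + l)"
proof -
  have mm: "(\<lambda>x. m x * n x) \<in> monomials T (k + l)" if "m \<in> monomials T k" "n \<in> monomials T l" for m n
  proof -
    obtain e where e: "\<And>t. t \<in> T \<Longrightarrow> e t \<le> k" "m = (\<lambda>x. \<Prod>t\<in>T. t x ^ e t)"
      using monomialsD[OF \<open>m \<in> monomials T k\<close>] by blast
    obtain f where f: "\<And>t. t \<in> T \<Longrightarrow> f t \<le> l" "n = (\<lambda>x. \<Prod>t\<in>T. t x ^ f t)"
      using monomialsD[OF \<open>n \<in> monomials T l\<close>] by blast
    have "(\<lambda>x. m x * n x) = (\<lambda>x. \<Prod>t\<in>T. t x ^ (e t + f t))"
      by (simp add: e(2) f(2) power_add prod.distrib)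
    then show ?thesis
      using e(1) f(1) by (auto intro!: monomialsI add_mono)
  qed
  have mq: "(\<lambda>x. m x * q x) \<in> boxpoly T (k + l)" if m: "m \<in> monomials T k" for m
  proof -
    have "(\<lambda>x. m x * q x) \<in> fun_space.span ((\<lambda>w x. m x * w x) ` monomials T l)"
      by (intro span_mult assms(2)[unfolded boxpoly_def])
    moreover have "(\<lambda>w x. m x * w x) ` monomials T l \<subseteq> monomials T (k + l)"
      using mm m by auto
    ultimately show ?thesis
      unfolding boxpoly_def using fun_space.span_mono by blast
  qed
  have "(\<lambda>x. q x * p x) \<in> fun_space.span ((\<lambda>w x. q x * w x) ` monomials T k)"
    by (intro span_mult assms(1)[unfolded boxpoly_def])
  moreover have "(\<lambda>w x. q x * w x) ` monomials T k \<subseteq> boxpoly T (k + l)"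
    using mq by (auto simp: mult.commute)
  then have "fun_space.span ((\<lambda>w x. q x * w x) ` monomials T k) \<subseteq> boxpoly T (k + l)"
    unfolding boxpoly_def by (intro fun_space.span_minimal fun_space.subspace_span)
  ultimately show ?thesis
    by (auto simp: mult.commute)
qed

definition ratfun :: "('a \<Rightarrow> complex) set \<Rightarrow> 'a set \<Rightarrow> ('a \<Rightarrow> complex) set" where
  "ratfun T S = {f. \<exists>k. \<exists>p\<in>boxpoly T k. \<exists>q\<in>boxpoly T k. \<forall>x\<in>S. q x \<noteq> 0 \<and> f x * q x = p x}"

lemma ratfunI:
  assumes "p \<in> boxpoly T k" "q \<in> boxpoly T l" "\<And>x. x \<in> S \<Longrightarrow> q x \<noteq> 0 \<and> f x * q x = p x"
  shows "f \<in> ratfun T S"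
  unfolding ratfun_def
  using assms boxpoly_mono[of k "k + l" T] boxpoly_mono[of l "k + l" T]
  by (intro CollectI exI[of _ "k + l"] bexI[of _ p] bexI[of _ q]) auto

lemma ratfun_const: "(\<lambda>x. c) \<in> ratfun T S"
  by (rule ratfunI[OF boxpoly_const[of c] boxpoly_const[of 1]]) auto

lemma ratfun_gen: "finite T \<Longrightarrow> t \<in> T \<Longrightarrow> t \<in> ratfun T S"
  by (rule ratfunI[OF boxpoly_gen boxpoly_const[of 1]]) auto

lemma ratfun_cong: "f \<in> ratfun T S \<Longrightarrow> (\<And>x. x \<in> S \<Longrightarrow> g x = f x) \<Longrightarrow> g \<in> ratfun T S"
  by (simp add: ratfun_def)

lemma ratfunD:
  assumes "f \<in> ratfun T S"
  shows "\<exists>k p q. p \<in> boxpoly T k \<and> q \<in> boxpoly T k \<and> (\<forall>x\<in>S. q x \<noteq> 0 \<and> f x = p x / q x)"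
proof -
  obtain k p q where "p \<in> boxpoly T k" "q \<in> boxpoly T k" "\<forall>x\<in>S. q x \<noteq> 0 \<and> f x * q x = p x"
    using assms unfolding ratfun_def by blast
  then show ?thesis
    by (intro exI[of _ k] exI[of _ p] exI[of _ q]) (auto simp: nonzero_eq_divide_eq)
qed

lemma ratfun_add:
  assumes "f \<in> ratfun T S" "g \<in> ratfun T S"
  shows "(\<lambda>x. f x + g x) \<in> ratfun T S"
proof -
  obtain k p q where f: "p \<in> boxpoly T k" "q \<in> boxpoly T k"
    "\<And>x. x \<in> S \<Longrightarrow> q x \<noteq> 0" "\<And>x. x \<in> S \<Longrightarrow> f x = p x / q x"
    using ratfunD[OF assms(1)] by blast
  obtain l r s where g: "r \<in> boxpoly T l" "s \<in> boxpoly T l"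
    "\<And>x. x \<in> S \<Longrightarrow> s x \<noteq> 0" "\<And>x. x \<in> S \<Longrightarrow> g x = r x / s x"
    using ratfunD[OF assms(2)] by blast
  have "(\<lambda>x. r x * q x) \<in> boxpoly T (k + l)"
    using boxpoly_mult[OF g(1) f(2)] by (simp add: add.commute)
  then show ?thesis
    using f g
    by (intro ratfunI[OF boxpoly_add[OF boxpoly_mult[OF f(1) g(2)]] boxpoly_mult[OF f(2) g(2)]])
      (auto simp: field_simps)
qed

lemma ratfun_mult:
  assumes "f \<in> ratfun T S" "g \<in> ratfun T S"
  shows "(\<lambda>x. f x * g x) \<in> ratfun T S"
proof -
  obtain k p q where f: "p \<in> boxpoly T k" "q \<in> boxpoly T k"
    "\<And>x. x \<in> S \<Longrightarrow> q x \<noteq> 0" "\<And>x. x \<in> S \<Longrightarrow> f x = p x / q x"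
    using ratfunD[OF assms(1)] by blast
  obtain l r s where g: "r \<in> boxpoly T l" "s \<in> boxpoly T l"
    "\<And>x. x \<in> S \<Longrightarrow> s x \<noteq> 0" "\<And>x. x \<in> S \<Longrightarrow> g x = r x / s x"
    using ratfunD[OF assms(2)] by blast
  show ?thesis
    using f g by (intro ratfunI[OF boxpoly_mult[OF f(1) g(1)] boxpoly_mult[OF f(2) g(2)]]) auto
qed

lemma ratfun_divide:
  assumes "f \<in> ratfun T S" "g \<in> ratfun T S" "\<And>x. x \<in> S \<Longrightarrow> g x \<noteq> 0"
  shows "(\<lambda>x. f x / g x) \<in> ratfun T S"
proof -
  obtain k p q where g: "p \<in> boxpoly T k" "q \<in> boxpoly T k"
    "\<And>x. x \<in> S \<Longrightarrow> q x \<noteq> 0" "\<And>x. x \<in> S \<Longrightarrow> g x = p x / q x"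
    using ratfunD[OF assms(2)] by blast
  have "(\<lambda>x. 1 / g x) \<in> ratfun T S"
    using g assms(3) by (intro ratfunI[OF g(2) g(1)]) auto
  from ratfun_mult[OF assms(1) this] show ?thesis
    by simp
qed

lemma ratfun_minus: "f \<in> ratfun T S \<Longrightarrow> (\<lambda>x. - f x) \<in> ratfun T S"
  using ratfun_mult[OF ratfun_const[of "- 1"]] by fastforce

lemma ratfun_sum: "(\<And>i. i \<in> I \<Longrightarrow> f i \<in> ratfun T S) \<Longrightarrow> (\<lambda>x. \<Sum>i\<in>I. f i x) \<in> ratfun T S"
  by (induction I rule: infinite_finite_induct) (auto intro: ratfun_const ratfun_add)

text \<open>The product of the denominators of all members of \<open>G\<close> serves.\<close>

lemma ratfun_common_denominator:
  assumes "finite G" "G \<subseteq> ratfun T S"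
  shows "\<exists>k. \<exists>q\<in>boxpoly T k. (\<forall>x\<in>S. q x \<noteq> 0) \<and> (\<forall>g\<in>G. \<exists>p\<in>boxpoly T k. \<forall>x\<in>S. g x * q x = p x)"
  using assms
proof (induction G)
  case empty
  show ?case
    by (intro exI[of _ 0] bexI[OF _ boxpoly_const[of 1]]) simp
next
  case (insert f G)
  obtain k q where q: "q \<in> boxpoly T k" "\<And>x. x \<in> S \<Longrightarrow> q x \<noteq> 0"
    and G: "\<And>g. g \<in> G \<Longrightarrow> \<exists>p\<in>boxpoly T k. \<forall>x\<in>S. g x * q x = p x"
    using insert.IH[OF order_trans[OF subset_insertI insert.prems]] by blast
  have "f \<in> ratfun T S"
    using insert.prems by simp
  then obtain l r s where f: "r \<in> boxpoly T l" "s \<in> boxpoly T l"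
    "\<And>x. x \<in> S \<Longrightarrow> s x \<noteq> 0" "\<And>x. x \<in> S \<Longrightarrow> f x = r x / s x"
    using ratfunD[of f T S] by blast
  have "\<exists>p\<in>boxpoly T (k + l). \<forall>x\<in>S. g x * (q x * s x) = p x" if gG: "g \<in> insert f G" for g
  proof (cases "g = f")
    case True
    then have "\<forall>x\<in>S. g x * (q x * s x) = q x * r x"
      using f by simp
    then show ?thesis
      by (rule bexI[OF _ boxpoly_mult[OF q(1) f(1)]])
  next
    case False
    then obtain p where p: "p \<in> boxpoly T k" "\<And>x. x \<in> S \<Longrightarrow> g x * q x = p x"
      using G[of g] gG by blast
    have "\<forall>x\<in>S. g x * (q x * s x) = p x * s x"
      by (simp add: p(2)[symmetric])
    then show ?thesis
      by (rule bexI[OF _ boxpoly_mult[OF p(1) f(2)]])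
  qed
  moreover have "\<forall>x\<in>S. q x * s x \<noteq> 0"
    using q(2) f(3) by simp
  ultimately show ?case
    by (intro exI[of _ "k + l"] bexI[OF _ boxpoly_mult[OF q(1) f(2)]]) blast
qed

text \<open>With a common denominator \<open>h\<close> of exponent bound \<open>k\<close>, a product
  of \<open>d\<close> members of \<open>G\<close> is a polynomial of exponent bound
  \<open>k * d\<close> over \<open>h ^ d\<close>. The monomials of that bound, divided by
  \<open>h ^ d\<close>, therefore span, and there are at most \<open>(Suc k * Suc d) ^ D\<close> of
  them.\<close>

lemma growth_le_ratfun:
  assumes T: "finite T" "card T \<le> D" and R: "R \<subseteq> ratfun T S"
  shows "growth_le D R S"
  unfolding growth_le_def
proof (intro allI impI, elim conjE)
  fix G assume G: "finite G" "G \<subseteq> R"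
  obtain k h where h: "h \<in> boxpoly T k" "\<And>x. x \<in> S \<Longrightarrow> h x \<noteq> 0"
    "\<And>g. g \<in> G \<Longrightarrow> \<exists>p\<in>boxpoly T k. \<forall>x\<in>S. g x * h x = p x"
    using ratfun_common_denominator[OF G(1) order_trans[OF G(2) R]] by blast
  have num: "\<exists>r\<in>boxpoly T (k * d). \<forall>x\<in>S. p x * h x ^ d = r x" if "p \<in> prods G d" for p d
    using that
  proof (induction d arbitrary: p)
    case 0
    then show ?case
      by (intro bexI[OF _ boxpoly_const[of 1]]) simp
  next
    case (Suc d)
    then obtain g p' where p: "p = (\<lambda>x. g x * p' x)" "g \<in> G" "p' \<in> prods G d"
      by auto
    obtain r where r: "r \<in> boxpoly T (k * d)" "\<And>x. x \<in> S \<Longrightarrow> p' x * h x ^ d = r x"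
      using Suc.IH[OF p(3)] by blast
    obtain s where s: "s \<in> boxpoly T k" "\<And>x. x \<in> S \<Longrightarrow> g x * h x = s x"
      using h(3)[OF p(2)] by blast
    have "\<forall>x\<in>S. p x * h x ^ Suc d = s x * r x"
      by (simp add: p(1) r(2)[symmetric] s(2)[symmetric])
    moreover have "(\<lambda>x. s x * r x) \<in> boxpoly T (k * Suc d)"
      using boxpoly_mult[OF s(1) r(1)] by simp
    ultimately show ?case
      by (intro bexI[of _ "\<lambda>x. s x * r x"])
  qed
  have "\<exists>W. finite W \<and> card W \<le> Suc k ^ D * Suc d ^ D \<and>
      (\<forall>p\<in>prods G d. \<exists>q\<in>fun_space.span W. \<forall>x\<in>S. q x = p x)" for d
  proof (intro exI conjI ballI)
    let ?W = "(\<lambda>w x. inverse (h x ^ d) * w x) ` monomials T (k * d)"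
    show "finite ?W"
      by (simp add: finite_monomials T)
    have "card ?W \<le> Suc (k * d) ^ card T"
      using card_image_le[OF finite_monomials[OF T(1)]] card_monomials_le[OF T(1)] le_trans by blast
    also have "\<dots> \<le> (Suc k * Suc d) ^ card T"
      by (intro power_mono) auto
    also have "\<dots> \<le> (Suc k * Suc d) ^ D"
      using T(2) by (intro power_increasing) auto
    finally show "card ?W \<le> Suc k ^ D * Suc d ^ D"
      by (simp only: power_mult_distrib)
    fix p assume "p \<in> prods G d"
    then obtain r where r: "r \<in> boxpoly T (k * d)" "\<And>x. x \<in> S \<Longrightarrow> p x * h x ^ d = r x"
      using num by blast
    have "(\<lambda>x. inverse (h x ^ d) * r x) \<in> fun_space.span ?W"
      by (intro span_mult r(1)[unfolded boxpoly_def])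
    moreover have "\<forall>x\<in>S. inverse (h x ^ d) * r x = p x"
      by (simp add: r(2)[symmetric] h(2))
    ultimately show "\<exists>q\<in>fun_space.span ?W. \<forall>x\<in>S. q x = p x"
      by (intro bexI[of _ "\<lambda>x. inverse (h x ^ d) * r x"])
  qed
  then show "\<exists>K. \<forall>d. \<exists>W. finite W \<and> card W \<le> K * Suc d ^ D \<and>
      (\<forall>p\<in>prods G d. \<exists>q\<in>fun_space.span W. \<forall>x\<in>S. q x = p x)"
    by blast
qed

text \<open>As a function of \<open>d\<close>, the binomial coefficient is at least
  \<open>((d + n) / n) ^ n\<close>, which grows with exponent \<open>n\<close>.\<close>

lemma exponent_le_of_binomial_le:
  assumes "\<And>d. (d + n) choose n \<le> K * Suc d ^ D"
  shows "n \<le> D"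
proof (rule ccontr)
  assume "\<not> n \<le> D"
  then have n: "n > D" "n \<ge> 1" by auto
  \<comment> \<open>This choice turns the upper bound for \<open>(d + n) ^ n\<close> into
    \<open>d * Suc d ^ D\<close>, which is less than \<open>Suc d ^ Suc D\<close>.\<close>
  define d where "d = n ^ n * K"
  have "(real (d + n) / real n) ^ n \<le> real ((d + n) choose n)"
    by (rule binomial_ge_n_over_k_pow_k) simp
  also have "\<dots> \<le> real (K * Suc d ^ D)"
    using assms[of d] by (simp only: of_nat_le_iff)
  finally have "real (d + n) ^ n \<le> real n ^ n * real (K * Suc d ^ D)"
    using n by (simp add: power_divide field_simps)
  then have "(d + n) ^ n \<le> n ^ n * (K * Suc d ^ D)"
    unfolding of_nat_mult[symmetric] of_nat_power[symmetric] of_nat_le_iff .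
  moreover have "Suc d ^ Suc D \<le> Suc d ^ n"
    using n by (intro power_increasing) auto
  moreover have "Suc d ^ n \<le> (d + n) ^ n"
    using n by (intro power_mono) auto
  moreover have "n ^ n * (K * Suc d ^ D) = d * Suc d ^ D"
    by (simp add: d_def)
  ultimately have "Suc d * Suc d ^ D \<le> d * Suc d ^ D"
    unfolding power_Suc by linarith
  then show False
    by simp
qed


section \<open>Chains of irreducible closed sets\<close>

locale biprojective = V: vector_space s1 + W: vector_space s2
  for s1 :: "complex \<Rightarrow> 'v::ab_group_add \<Rightarrow> 'v" and s2 :: "complex \<Rightarrow> 'w::ab_group_add \<Rightarrow> 'w" +
  fixes W1 :: "'v set" and W2 :: "'w set"
begin

text \<open>Points are replaced by pairs of nonzero representatives, where a bihomogeneous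
  polynomial has a value and not only a zero or nonzero status.\<close>

definition cone :: "('v set \<times> 'w set) set \<Rightarrow> ('v \<times> 'w) set" where
  "cone Z = {(v, w). v \<in> W1 \<and> v \<noteq> 0 \<and> w \<in> W2 \<and> w \<noteq> 0 \<and> (V.span {v}, W.span {w}) \<in> Z}"

section \<open>Bihomogeneous polynomials with explicit bidegree\<close>

definition bihom :: "nat \<Rightarrow> nat \<Rightarrow> ('v \<times> 'w \<Rightarrow> complex) \<Rightarrow> bool" where
  "bihom d e f \<longleftrightarrow> complex_poly_fun (module_prod.scale s1 s2) f \<and>
     (\<forall>a b v w. f (s1 a v, s2 b w) = a ^ d * b ^ e * f (v, w))"

lemma bihomogeneous_iff: "bihomogeneous s1 s2 f \<longleftrightarrow> (\<exists>d e. bihom d e f)"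
  by (auto simp: bihomogeneous_def bihom_def)

lemma bihom_const: "bihom 0 0 (\<lambda>x. c)"
  by (auto simp: bihom_def intro: complex_poly_fun.const)

lemma bihom_mult: "bihom d e f \<Longrightarrow> bihom d' e' g \<Longrightarrow> bihom (d + d') (e + e') (\<lambda>x. f x * g x)"
  by (auto simp: bihom_def power_add intro: complex_poly_fun.mult)

lemma bihom_power: "bihom d e f \<Longrightarrow> bihom (k * d) (k * e) (\<lambda>x. f x ^ k)"
proof (induction k)
  case 0
  show ?case
    using bihom_const[of 1] by simp
next
  case (Suc k)
  then show ?case
    using bihom_mult[of d e f "k * d" "k * e"] by simp
qed

lemma bihom_sum:
  assumes "\<And>i. i < N \<Longrightarrow> bihom d e (f i)"
  shows "bihom d e (\<lambda>x. \<Sum>i<N::nat. c i * f i x)"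
  using assms
proof (induction N)
  case 0
  show ?case
    by (auto simp: bihom_def intro: complex_poly_fun.const)
next
  case (Suc N)
  then have "bihom d e (\<lambda>x. \<Sum>i<N. c i * f i x)" "bihom d e (f N)"
    by auto
  then show ?case
    by (auto simp: bihom_def distrib_left mult.left_commute
        intro!: complex_poly_fun.add complex_poly_fun.mult complex_poly_fun.const)
qed

lemma bihom_prods:
  assumes "\<And>g. g \<in> G \<Longrightarrow> bihom d e g" "p \<in> prods G k"
  shows "bihom (k * d) (k * e) p"
  using assms(2)
proof (induction k arbitrary: p)
  case 0
  then show ?case
    using bihom_const[of 1] by simp
next
  case (Suc k)
  then show ?case
    using bihom_mult[OF assms(1)] by fastforce
qed

text \<open>A functional with value 1 at \<open>v\<close> exists because \<open>{v}\<close> is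
  independent. Powers of such a form raise one component of the bidegree without introducing a zero
  at a given point.\<close>

lemma exists_bihom_fst:
  assumes "v \<noteq> 0"
  shows "\<exists>l. bihom 1 0 l \<and> (\<forall>w. l (v, w) \<noteq> 0)"
proof -
  interpret P: vector_space_pair s1 "(*) :: complex \<Rightarrow> _"
    by unfold_locales (auto simp: algebra_simps)
  interpret VW: vector_space_prod s1 s2 ..
  obtain g where g: "Vector_Spaces.linear s1 (*) g" "g v = 1"
    using P.linear_independent_extend[of "{v}" "\<lambda>_. 1"] assms by auto
  interpret g: Vector_Spaces.linear s1 "(*)" g
    by fact
  have "Vector_Spaces.linear (module_prod.scale s1 s2) (*) (\<lambda>x. g (fst x))"
    by unfold_locales (auto simp: g.add g.scale VW.scale_def algebra_simps)
  then have "bihom 1 0 (\<lambda>x. g (fst x))"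
    by (auto simp: bihom_def g.scale intro: complex_poly_fun.linear)
  then show ?thesis
    using g by (intro exI[of _ "\<lambda>x. g (fst x)"]) auto
qed

lemma exists_bihom_snd:
  assumes "w \<noteq> 0"
  shows "\<exists>l. bihom 0 1 l \<and> (\<forall>v. l (v, w) \<noteq> 0)"
proof -
  interpret P: vector_space_pair s2 "(*) :: complex \<Rightarrow> _"
    by unfold_locales (auto simp: algebra_simps)
  interpret VW: vector_space_prod s1 s2 ..
  obtain g where g: "Vector_Spaces.linear s2 (*) g" "g w = 1"
    using P.linear_independent_extend[of "{w}" "\<lambda>_. 1"] assms by auto
  interpret g: Vector_Spaces.linear s2 "(*)" g
    by fact
  have "Vector_Spaces.linear (module_prod.scale s1 s2) (*) (\<lambda>x. g (snd x))"
    by unfold_locales (auto simp: g.add g.scale VW.scale_def algebra_simps)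
  then have "bihom 0 1 (\<lambda>x. g (snd x))"
    by (auto simp: bihom_def g.scale intro: complex_poly_fun.linear)
  then show ?thesis
    using g by (intro exI[of _ "\<lambda>x. g (snd x)"]) auto
qed

section \<open>Closed sets and polynomials on their cones\<close>

abbreviation zariski :: "('v set \<times> 'w set) topology" where
  "zariski \<equiv> zariski_topology s1 s2 W1 W2"

abbreviation zeros :: "('v \<times> 'w \<Rightarrow> complex) set \<Rightarrow> ('v set \<times> 'w set) set" where
  "zeros \<equiv> bizero_locus s1 s2 W1 W2"

lemma zeros_subset: "zeros F \<subseteq> proj_space s1 W1 \<times> proj_space s2 W2"
  by (auto simp: bizero_locus_def)

lemma mem_cone_zeros:
  assumes "\<forall>f\<in>F. bihomogeneous s1 s2 f"
  shows "x \<in> cone (zeros F \<inter> Z) \<longleftrightarrow> x \<in> cone Z \<and> (\<forall>f\<in>F. f x = 0)"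
proof (cases x)
  case (Pair v w)
  then show ?thesis
    using bizero_locus_span_iff[OF V.vector_space_axioms W.vector_space_axioms _ _ _ _ assms, of v W1 w W2]
    by (auto simp: cone_def)
qed

lemma cone_mono: "Z \<subseteq> Z' \<Longrightarrow> cone Z \<subseteq> cone Z'"
  by (auto simp: cone_def)

text \<open>Every point of the product of the projective spaces has a representative pair, so
  inclusions can be tested on vectors.\<close>

lemma subset_if_cone_subset:
  assumes "Z \<subseteq> proj_space s1 W1 \<times> proj_space s2 W2" "cone Z \<subseteq> cone Z'"
  shows "Z \<subseteq> Z'"
proof
  fix p assume p: "p \<in> Z"
  then have "p \<in> proj_space s1 W1 \<times> proj_space s2 W2"
    using assms(1) by blast
  then obtain v w where vw: "p = (V.span {v}, W.span {w})" "v \<in> W1" "v \<noteq> 0" "w \<in> W2" "w \<noteq> 0"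
    unfolding proj_space_def by blast
  then have "(v, w) \<in> cone Z"
    using p by (simp add: cone_def)
  then have "(v, w) \<in> cone Z'"
    using assms(2) by blast
  then show "p \<in> Z'"
    using vw(1) by (simp add: cone_def)
qed

lemma closedin_zariski:
  "closedin (subtopology zariski Y) Z \<longleftrightarrow> (\<exists>F. (\<forall>f\<in>F. bihomogeneous s1 s2 f) \<and> Z = zeros F \<inter> Y)"
  unfolding closedin_subtopology
    closedin_zariski_topology[OF V.vector_space_axioms W.vector_space_axioms]
  by blast

lemma closedin_zariski_subset:
  "closedin (subtopology zariski Y) Z \<Longrightarrow> Z \<subseteq> proj_space s1 W1 \<times> proj_space s2 W2"
  unfolding closedin_zariski using zeros_subset by blast

lemma irreducible_cone_nonempty:
  assumes "irreducible_closedin (subtopology zariski Y) Z"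
  shows "cone Z \<noteq> {}"
proof
  assume "cone Z = {}"
  moreover have "Z \<subseteq> proj_space s1 W1 \<times> proj_space s2 W2"
    using assms closedin_zariski_subset[of Y Z] by (simp add: irreducible_closedin_def)
  ultimately have "Z \<subseteq> {}"
    using subset_if_cone_subset[of Z "{}"] by simp
  then show False
    using assms by (simp add: irreducible_closedin_def)
qed

text \<open>The zero loci of \<open>f\<close> and \<open>g\<close> in \<open>Z\<close> are closed
  and cover \<open>Z\<close>, so one of them is \<open>Z\<close>. This is the form in which
  irreducibility is used: nonzero bihomogeneous factors can be cancelled, as in an integral
  domain.\<close>

lemma irreducible_mult_eq_0:
  assumes Z: "irreducible_closedin (subtopology zariski Y) Z"
    and f: "bihom d e f" and g: "bihom d' e' g"
    and 0: "\<And>x. x \<in> cone Z \<Longrightarrow> f x * g x = 0"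
  shows "(\<forall>x\<in>cone Z. f x = 0) \<or> (\<forall>x\<in>cone Z. g x = 0)"
proof -
  have fg: "\<forall>h\<in>{f}. bihomogeneous s1 s2 h" "\<forall>h\<in>{g}. bihomogeneous s1 s2 h"
    using f g by (auto simp: bihomogeneous_iff)
  have cl: "closedin (subtopology zariski Y) Z"
    using Z by (simp add: irreducible_closedin_def)
  then have ZY: "Z \<subseteq> Y"
    by (auto simp: closedin_zariski)
  have "closedin (subtopology zariski Y) (zeros {h} \<inter> Z)" if h: "\<forall>h\<in>{h}. bihomogeneous s1 s2 h" for h
  proof -
    have "closedin (subtopology zariski Y) (zeros {h} \<inter> Y)"
      unfolding closedin_zariski using h by blast
    then have "closedin (subtopology zariski Y) ((zeros {h} \<inter> Y) \<inter> Z)"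
      by (rule closedin_Int[OF _ cl])
    then show ?thesis
      using ZY by (simp add: Int_assoc Int_absorb1)
  qed
  note fgcl = this[OF fg(1)] this[OF fg(2)]
  have "cone Z \<subseteq> cone (zeros {f} \<inter> Z \<union> zeros {g} \<inter> Z)"
  proof
    fix x assume x: "x \<in> cone Z"
    then consider "f x = 0" | "g x = 0"
      using 0 by fastforce
    then have "x \<in> cone (zeros {f} \<inter> Z) \<union> cone (zeros {g} \<inter> Z)"
      using mem_cone_zeros[OF fg(1), of x Z] mem_cone_zeros[OF fg(2), of x Z] x by cases auto
    then show "x \<in> cone (zeros {f} \<inter> Z \<union> zeros {g} \<inter> Z)"
      by (auto simp: cone_def)
  qed
  then have "Z \<subseteq> zeros {f} \<inter> Z \<union> zeros {g} \<inter> Z"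
    by (rule subset_if_cone_subset[OF closedin_zariski_subset[OF cl]])
  then have "Z = zeros {f} \<inter> Z \<union> zeros {g} \<inter> Z"
    by blast
  then consider "Z = zeros {f} \<inter> Z" | "Z = zeros {g} \<inter> Z"
    using Z fgcl unfolding irreducible_closedin_def by metis
  then show ?thesis
    using mem_cone_zeros[OF fg(1), of _ Z] mem_cone_zeros[OF fg(2), of _ Z] by cases auto
qed

text \<open>One of the equations of the smaller set fails at some vector over the larger
  one.\<close>

lemma exists_separating_bihom:
  assumes "closedin (subtopology zariski Y) Z" "closedin (subtopology zariski Y) Z'" "Z \<subset> Z'"
  shows "\<exists>d e f. bihom d e f \<and> (\<forall>x\<in>cone Z. f x = 0) \<and> (\<exists>x\<in>cone Z'. f x \<noteq> 0)"
proof -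
  obtain F where F: "\<forall>f\<in>F. bihomogeneous s1 s2 f" "Z = zeros F \<inter> Y"
    using assms(1) by (auto simp: closedin_zariski)
  have "Z' \<subseteq> Y"
    using assms(2) by (auto simp: closedin_zariski)
  then have Z: "Z = zeros F \<inter> Z'"
    using F(2) assms(3) by blast
  have "\<not> cone Z' \<subseteq> cone Z"
    using subset_if_cone_subset[OF closedin_zariski_subset[OF assms(2)]] assms(3) by blast
  then obtain x where "x \<in> cone Z'" "x \<notin> cone Z"
    by blast
  then obtain f where f: "f \<in> F" "f x \<noteq> 0"
    using mem_cone_zeros[OF F(1), of x Z'] Z by auto
  have "\<forall>x\<in>cone Z. f x = 0"
    using mem_cone_zeros[OF F(1), of _ Z'] Z f(1) by auto
  then show ?thesis
    using f F(1) \<open>x \<in> cone Z'\<close> unfolding bihomogeneous_iff by blast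
qed

text \<open>Multiplication by powers of two linear forms brings all the separating polynomials of a chain
  to the same bidegree.\<close>

lemma chain_separating_bihoms:
  assumes Z: "\<And>i. i \<le> n \<Longrightarrow> irreducible_closedin (subtopology zariski Y) (Z i)"
    and strict: "\<And>i. i < n \<Longrightarrow> Z i \<subset> Z (Suc i)"
  shows "\<exists>e g. (\<forall>i\<le>n. bihom e e (g i) \<and> (\<exists>x\<in>cone (Z i). g i x \<noteq> 0)) \<and>
    (\<forall>i<n. \<forall>x\<in>cone (Z i). g (Suc i) x = 0)"
proof -
  have cl: "closedin (subtopology zariski Y) (Z i)" if "i \<le> n" for i
    using Z[OF that] by (simp add: irreducible_closedin_def)
  have "\<exists>h d e. bihom d e h \<and> (\<exists>x\<in>cone (Z i). h x \<noteq> 0) \<and>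
      (\<forall>j. i = Suc j \<longrightarrow> (\<forall>x\<in>cone (Z j). h x = 0))" if i: "i \<le> n" for i
  proof (cases i)
    case 0
    have "\<exists>x\<in>cone (Z i). (1 :: complex) \<noteq> 0"
      using irreducible_cone_nonempty[OF Z[OF i]] by auto
    then show ?thesis
      using 0 bihom_const[of 1] by blast
  next
    case (Suc j)
    then have "closedin (subtopology zariski Y) (Z j)" "closedin (subtopology zariski Y) (Z (Suc j))"
      "Z j \<subset> Z (Suc j)"
      using cl strict i by auto
    from exists_separating_bihom[OF this] show ?thesis
      unfolding Suc by blast
  qed
  then obtain h p q where h: "\<And>i. i \<le> n \<Longrightarrow> bihom (p i) (q i) (h i)"
    "\<And>i. i \<le> n \<Longrightarrow> \<exists>x\<in>cone (Z i). h i x \<noteq> 0"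
    and sep: "\<And>i x. Suc i \<le> n \<Longrightarrow> x \<in> cone (Z i) \<Longrightarrow> h (Suc i) x = 0"
    by metis
  have sub: "Z 0 \<subseteq> Z i" if "i \<le> n" for i
    using that
  proof (induction i)
    case (Suc i)
    then show ?case
      using strict[of i] by auto
  qed simp
  \<comment> \<open>A point of the smallest member lies in all of them. The multipliers
    \<open>m i\<close> do not vanish there, hence vanish identically on no \<open>Z i\<close>, and
    by irreducibility neither does \<open>h i * m i\<close>.\<close>
  obtain v w where vw: "(v, w) \<in> cone (Z 0)"
    using irreducible_cone_nonempty[OF Z[of 0]] by auto
  then have "v \<noteq> 0" "w \<noteq> 0"
    by (auto simp: cone_def)
  then obtain l1 l2 where l: "bihom 1 0 l1" "l1 (v, w) \<noteq> 0" "bihom 0 1 l2" "l2 (v, w) \<noteq> 0"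
    using exists_bihom_fst exists_bihom_snd by meson
  define e where "e = (\<Sum>i\<le>n. p i + q i)"
  define m where "m = (\<lambda>i x. l1 x ^ (e - p i) * l2 x ^ (e - q i))"
  have le: "p i \<le> e \<and> q i \<le> e" if "i \<le> n" for i
    using member_le_sum[of i "{..n}" "\<lambda>i. p i + q i"] that by (simp add: e_def)
  have m: "bihom (e - p i) (e - q i) (m i)" for i
    using bihom_mult[OF bihom_power[OF l(1)] bihom_power[OF l(3)]] by (simp add: m_def)
  have "bihom e e (\<lambda>x. h i x * m i x) \<and> (\<exists>x\<in>cone (Z i). h i x * m i x \<noteq> 0)" if i: "i \<le> n" for i
  proof
    show "bihom e e (\<lambda>x. h i x * m i x)"
      using bihom_mult[OF h(1)[OF i] m[of i]] le[OF i] by simp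
    have "(v, w) \<in> cone (Z i)" "m i (v, w) \<noteq> 0"
      using vw cone_mono[OF sub[OF i]] l by (auto simp: m_def)
    then show "\<exists>x\<in>cone (Z i). h i x * m i x \<noteq> 0"
      using irreducible_mult_eq_0[OF Z[OF i] h(1)[OF i] m[of i]] h(2)[OF i] by blast
  qed
  moreover have "\<forall>i<n. \<forall>x\<in>cone (Z i). h (Suc i) x * m (Suc i) x = 0"
    using sep by auto
  ultimately show ?thesis
    by (intro exI[of _ e] exI[of _ "\<lambda>i x. h i x * m i x"]) auto
qed

text \<open>Products of degree \<open>d\<close> of the \<open>g 0, \<dots>, g i\<close>, independent on \<open>Z i\<close>: those without \<open>g i\<close> are
  independent already on \<open>Z (i - 1)\<close>, where \<open>g i\<close> vanishes, whence Pascal's rule.\<close>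

lemma chain_independent_prods:
  assumes Z: "\<And>i. i \<le> n \<Longrightarrow> irreducible_closedin (subtopology zariski Y) (Z i)"
    and strict: "\<And>i. i < n \<Longrightarrow> Z i \<subset> Z (Suc i)"
    and g: "\<And>i. i \<le> n \<Longrightarrow> bihom e e (g i)" "\<And>i. i \<le> n \<Longrightarrow> \<exists>x\<in>cone (Z i). g i x \<noteq> 0"
    and sep: "\<And>i x. i < n \<Longrightarrow> x \<in> cone (Z i) \<Longrightarrow> g (Suc i) x = 0"
    and "i \<le> n"
  shows "\<exists>f. (\<forall>j<(d + i) choose i. f j \<in> prods (g ` {..n}) d) \<and>
    indep_on (cone (Z i)) ((d + i) choose i) f"
  using \<open>i \<le> n\<close>
proof (induction i arbitrary: d)
  case 0
  have "(\<lambda>x. g 0 x ^ d) \<in> prods (g ` {..n}) d"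
  proof (induction d)
    case (Suc d)
    then show ?case by fastforce
  qed simp
  moreover have "indep_on (cone (Z 0)) ((d + 0) choose 0) (\<lambda>j x. g 0 x ^ d)"
    using g(2)[of 0] by (auto simp: indep_on_def)
  ultimately show ?case
    by (intro exI[of _ "\<lambda>j x. g 0 x ^ d"]) auto
next
  case (Suc i)
  note IH = Suc.IH
  show ?case
  proof (induction d)
    case 0
    have "indep_on (cone (Z (Suc i))) ((0 + Suc i) choose Suc i) (\<lambda>j x. 1)"
      using irreducible_cone_nonempty[OF Z[OF Suc.prems]] by (auto simp: indep_on_def)
    then show ?case
      by (intro exI[of _ "\<lambda>j x. 1"]) auto
  next
    case (Suc d)
    let ?N1 = "(Suc d + i) choose i" and ?N2 = "(d + Suc i) choose Suc i"
    have N: "(Suc d + Suc i) choose Suc i = ?N1 + ?N2"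
      by simp
    obtain f1 where f1: "\<And>j. j < ?N1 \<Longrightarrow> f1 j \<in> prods (g ` {..n}) (Suc d)"
      "indep_on (cone (Z i)) ?N1 f1"
      using IH[of "Suc d"] \<open>Suc i \<le> n\<close> by auto
    obtain f2 where f2: "\<And>j. j < ?N2 \<Longrightarrow> f2 j \<in> prods (g ` {..n}) d"
      "indep_on (cone (Z (Suc i))) ?N2 f2"
      using Suc.IH by blast
    define f where "f = (\<lambda>j. if j < ?N1 then f1 j else (\<lambda>x. g (Suc i) x * f2 (j - ?N1) x))"
    have split: "(\<Sum>j<?N1 + ?N2. c j * f j x)
        = (\<Sum>j<?N1. c j * f1 j x) + g (Suc i) x * (\<Sum>j<?N2. c (?N1 + j) * f2 j x)" for c x
      unfolding sum_lessThan_add by (simp add: f_def sum_distrib_left mult_ac)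
    have "f j \<in> prods (g ` {..n}) (Suc d)" if "j < ?N1 + ?N2" for j
    proof (cases "j < ?N1")
      case True
      then show ?thesis
        using f1(1) by (simp add: f_def)
    next
      case False
      then have "f2 (j - ?N1) \<in> prods (g ` {..n}) d"
        using that by (intro f2(1)) linarith
      moreover have "g (Suc i) \<in> g ` {..n}"
        using \<open>Suc i \<le> n\<close> by simp
      moreover have "f j = (\<lambda>x. g (Suc i) x * f2 (j - ?N1) x)"
        using False by (simp only: f_def if_False)
      ultimately show ?thesis
        unfolding prods.simps by blast
    qed
    moreover have "indep_on (cone (Z (Suc i))) (?N1 + ?N2) f"
      unfolding indep_on_def
    proof (intro allI impI)
      fix c j
      assume c: "\<forall>x\<in>cone (Z (Suc i)). (\<Sum>j<?N1 + ?N2. c j * f j x) = 0" and j: "j < ?N1 + ?N2"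
      have "(\<Sum>j<?N1. c j * f1 j x) = 0" if x: "x \<in> cone (Z i)" for x
      proof -
        have x': "x \<in> cone (Z (Suc i))"
          using x cone_mono[OF psubset_imp_subset[OF strict[of i]]] \<open>Suc i \<le> n\<close> by auto
        then show ?thesis
          using bspec[OF c x', unfolded split] sep[of i x] x \<open>Suc i \<le> n\<close> by simp
      qed
      then have c1: "\<forall>j<?N1. c j = 0"
        using f1(2) unfolding indep_on_def by blast
      \<comment> \<open>All \<open>g i\<close> have the same bidegree, so this combination is
        bihomogeneous, and the factor \<open>g (Suc i)\<close> can be cancelled on the irreducible
        set \<open>Z (Suc i)\<close>.\<close>
      have b: "bihom (d * e) (d * e) (\<lambda>x. \<Sum>j<?N2. c (?N1 + j) * f2 j x)"
        using f2(1) g(1) by (intro bihom_sum bihom_prods[of "g ` {..n}"]) auto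
      have "g (Suc i) x * (\<Sum>j<?N2. c (?N1 + j) * f2 j x) = 0" if "x \<in> cone (Z (Suc i))" for x
        using bspec[OF c that, unfolded split] c1 by simp
      then have "\<forall>x\<in>cone (Z (Suc i)). (\<Sum>j<?N2. c (?N1 + j) * f2 j x) = 0"
        using irreducible_mult_eq_0[OF Z g(1) b, of "Suc i" "Suc i"] g(2)[of "Suc i"] \<open>Suc i \<le> n\<close>
        by blast
      then have "\<forall>j<?N2. c (?N1 + j) = 0"
        using f2(2) unfolding indep_on_def by (elim allE[of _ "\<lambda>j. c (?N1 + j)"]) blast
      then show "c j = 0"
        using c1 j by (cases "j < ?N1") (auto simp: not_less le_iff_add)
    qed
    ultimately show ?case
      unfolding N by (intro exI[of _ f]) auto
  qed
qed

text \<open>\<open>X\<close> is a normalised slice into which every point over \<open>Y\<close> can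
  be rescaled. A bihomogeneous combination that vanishes on \<open>X\<close> vanishes on the cone of
  \<open>Z n\<close>, so the independent products of the chain stay independent on \<open>X\<close>,
  where the growth bound limits their number.\<close>

theorem chain_length_le:
  assumes Z: "\<And>i. i \<le> n \<Longrightarrow> irreducible_closedin (subtopology zariski Y) (Z i)"
    and strict: "\<And>i. i < n \<Longrightarrow> Z i \<subset> Z (Suc i)"
    and X: "growth_le D {f. complex_poly_fun (module_prod.scale s1 s2) f} X"
    and scale: "\<And>v w. (v, w) \<in> cone Y \<Longrightarrow> \<exists>a b. a \<noteq> 0 \<and> b \<noteq> 0 \<and> (s1 a v, s2 b w) \<in> X"
  shows "n \<le> D"
proof -
  obtain e g where g: "\<And>i. i \<le> n \<Longrightarrow> bihom e e (g i)" "\<And>i. i \<le> n \<Longrightarrow> \<exists>x\<in>cone (Z i). g i x \<noteq> 0"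
    and sep: "\<And>i x. i < n \<Longrightarrow> x \<in> cone (Z i) \<Longrightarrow> g (Suc i) x = 0"
    using chain_separating_bihoms[of n Y Z, OF Z strict] by blast
  have G: "finite (g ` {..n})" "g ` {..n} \<subseteq> {f. complex_poly_fun (module_prod.scale s1 s2) f}"
    using g(1) by (auto simp: bihom_def)
  obtain K where K: "\<And>d. \<exists>W. finite W \<and> card W \<le> K * Suc d ^ D \<and>
      (\<forall>p\<in>prods (g ` {..n}) d. \<exists>q\<in>fun_space.span W. \<forall>x\<in>X. q x = p x)"
    using X G unfolding growth_le_def by meson
  have ZY: "Z n \<subseteq> Y"
    using Z[of n] by (auto simp: irreducible_closedin_def closedin_zariski)
  have "(d + n) choose n \<le> K * Suc d ^ D" for d
  proof -
    obtain f where f: "\<And>j. j < (d + n) choose n \<Longrightarrow> f j \<in> prods (g ` {..n}) d"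
      and ind: "indep_on (cone (Z n)) ((d + n) choose n) f"
      using chain_independent_prods[of n Y Z e g n d, OF Z strict g sep] by blast
    obtain W where W: "finite W" "card W \<le> K * Suc d ^ D"
      and span: "\<And>p. p \<in> prods (g ` {..n}) d \<Longrightarrow> \<exists>q\<in>fun_space.span W. \<forall>x\<in>X. q x = p x"
      using K by meson
    have "indep_on X ((d + n) choose n) f"
      unfolding indep_on_def
    proof (intro allI impI)
      fix c j
      assume c: "\<forall>x\<in>X. (\<Sum>j<(d + n) choose n. c j * f j x) = 0" and j: "j < (d + n) choose n"
      have b: "bihom (d * e) (d * e) (\<lambda>x. \<Sum>j<(d + n) choose n. c j * f j x)"
        using f g(1) by (intro bihom_sum bihom_prods[of "g ` {..n}"]) auto
      have "(\<Sum>j<(d + n) choose n. c j * f j x) = 0" if x: "x \<in> cone (Z n)" for x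
      proof -
        obtain v w where vw: "x = (v, w)"
          by (cases x)
        obtain a b where ab: "a \<noteq> 0" "b \<noteq> 0" "(s1 a v, s2 b w) \<in> X"
          using scale[of v w] x vw cone_mono[OF ZY] by blast
        have "a ^ (d * e) * b ^ (d * e) * (\<Sum>j<(d + n) choose n. c j * f j (v, w)) = 0"
          using b c ab(3) unfolding bihom_def by fastforce
        then show ?thesis
          using ab vw by simp
      qed
      then show "c j = 0"
        using ind j unfolding indep_on_def by blast
    qed
    then have "(d + n) choose n \<le> card W"
      using W(1) span[OF f] by (rule indep_on_le_card)
    with W(2) show ?thesis
      by linarith
  qed
  then show ?thesis
    by (rule exponent_le_of_binomial_le)
qed

text \<open>The chain consists of the closures of the images of coordinate subspaces under \<open>\<phi>\<close>. The
  coordinates are switched on in an order that respects the stages \<open>st\<close>.\<close>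

theorem chain_of_parametrization:
  fixes \<phi> :: "('p \<Rightarrow> complex) \<Rightarrow> 'v \<times> 'w" and st :: "'p \<Rightarrow> nat"
  assumes P: "finite P"
    and cone: "\<And>t. \<phi> t \<in> cone Y"
    and line: "\<And>f t t'. complex_poly_fun (module_prod.scale s1 s2) f \<Longrightarrow>
      \<exists>p. \<forall>s. f (\<phi> (\<lambda>c. t c + s * (t' c - t c))) = poly p s"
    and sep: "\<And>c. c \<in> P \<Longrightarrow> bihomogeneous s1 s2 (x c)"
    and sep_0: "\<And>c t. c \<in> P \<Longrightarrow> t c = 0 \<Longrightarrow> (\<And>c'. t c' \<noteq> 0 \<Longrightarrow> st c' \<le> st c) \<Longrightarrow> x c (\<phi> t) = 0"
    and sep_1: "\<And>c. c \<in> P \<Longrightarrow>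
      \<exists>t. (\<forall>c'. t c' \<noteq> 0 \<longrightarrow> c' = c \<or> c' \<in> P \<and> st c' < st c) \<and> x c (\<phi> t) \<noteq> 0"
  shows "\<exists>Z. (\<forall>i\<le>card P. irreducible_closedin (subtopology zariski Y) (Z i)) \<and>
    (\<forall>i<card P. Z i \<subset> Z (Suc i))"
proof -
  define T where "T = (\<lambda>Q. {t :: 'p \<Rightarrow> complex. \<forall>c. t c \<noteq> 0 \<longrightarrow> c \<in> Q})"
  define I where "I = (\<lambda>Q. {f. bihomogeneous s1 s2 f \<and> (\<forall>t\<in>T Q. f (\<phi> t) = 0)})"
  define C where "C = (\<lambda>Q. zeros (I Q) \<inter> Y)"
  have I: "\<forall>f\<in>I Q. bihomogeneous s1 s2 f" for Q
    by (simp add: I_def)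
  have mem: "\<phi> t \<in> cone (C Q)" if "t \<in> T Q" for t Q
    using mem_cone_zeros[OF I, of "\<phi> t" Q Y] cone[of t] that by (auto simp: C_def I_def)
  have mono: "C Q \<subseteq> C Q'" if "Q \<subseteq> Q'" for Q Q'
  proof -
    have "I Q' \<subseteq> I Q"
      using that by (auto simp: I_def T_def)
    then show ?thesis
      by (auto simp: C_def bizero_locus_def)
  qed
  have irr: "irreducible_closedin (subtopology zariski Y) (C Q)" for Q
    unfolding irreducible_closedin_def
  proof (intro conjI allI impI; (elim conjE)?)
    show "closedin (subtopology zariski Y) (C Q)"
      unfolding closedin_zariski C_def using I by blast
    have "(\<lambda>c. 0) \<in> T Q"
      by (simp add: T_def)
    then show "C Q \<noteq> {}"
      using mem[of "\<lambda>c. 0" Q] by (auto simp: cone_def)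
    fix A B assume "closedin (subtopology zariski Y) A" "closedin (subtopology zariski Y) B"
      and AB: "C Q = A \<union> B"
    then obtain F G where F: "\<forall>f\<in>F. bihomogeneous s1 s2 f" "A = zeros F \<inter> Y"
      and G: "\<forall>f\<in>G. bihomogeneous s1 s2 f" "B = zeros G \<inter> Y"
      unfolding closedin_zariski by blast
    show "C Q = A \<or> C Q = B"
    proof (rule ccontr)
      assume neq: "\<not> (C Q = A \<or> C Q = B)"
      have "C Q \<subseteq> zeros H \<inter> Y" if "H \<subseteq> I Q" for H
        using that by (auto simp: C_def bizero_locus_def)
      then have "\<not> F \<subseteq> I Q" "\<not> G \<subseteq> I Q"
        using neq AB F(2) G(2) by blast+
      then obtain f g t t' where f: "f \<in> F" "t \<in> T Q" "f (\<phi> t) \<noteq> 0"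
        and g: "g \<in> G" "t' \<in> T Q" "g (\<phi> t') \<noteq> 0"
        using F(1) G(1) unfolding I_def by blast
      \<comment> \<open>The line joining the two parameter points stays in the coordinate subspace.
        Along it \<open>f\<close> and \<open>g\<close> are nonzero univariate polynomials, so at
        some point of it neither vanishes, although the image of that point lies in \<open>A\<close>
        or \<open>B\<close>.\<close>
      define \<gamma> where "\<gamma> = (\<lambda>s c. t c + s * (t' c - t c))"
      obtain p where p: "\<And>s. f (\<phi> (\<gamma> s)) = poly p s"
        using line[of f t t'] F(1) f(1) unfolding \<gamma>_def bihomogeneous_def by blast
      obtain q where q: "\<And>s. g (\<phi> (\<gamma> s)) = poly q s"
        using line[of g t t'] G(1) g(1) unfolding \<gamma>_def bihomogeneous_def by blast
      have "\<gamma> 0 = t" "\<gamma> 1 = t'"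
        by (simp_all add: \<gamma>_def)
      then have "p \<noteq> 0" "q \<noteq> 0"
        using f(3) g(3) p[of 0] q[of 1] by auto
      then have "p * q \<noteq> 0"
        by simp
      then have "finite {s. poly (p * q) s = 0}"
        by (rule poly_roots_finite)
      then obtain s where s: "poly (p * q) s \<noteq> 0"
        using infinite_UNIV_char_0[where 'a = complex] by (metis (mono_tags) UNIV_eq_I mem_Collect_eq)
      have "\<gamma> s \<in> T Q"
        using f(2) g(2) by (force simp: T_def \<gamma>_def)
      then have "\<phi> (\<gamma> s) \<in> cone A \<union> cone B"
        using mem[of "\<gamma> s" Q] AB by (auto simp: cone_def)
      then have "f (\<phi> (\<gamma> s)) = 0 \<or> g (\<phi> (\<gamma> s)) = 0"
        using mem_cone_zeros[OF F(1), of "\<phi> (\<gamma> s)" Y] mem_cone_zeros[OF G(1), of "\<phi> (\<gamma> s)" Y]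
          F(2) G(2) f(1) g(1) by auto
      then show False
        using s by (simp add: p q)
    qed
  qed
  obtain ys where ys: "set ys = P" "distinct ys"
    using finite_distinct_list[OF P] by blast
  \<comment> \<open>A parameter thus comes after all those of strictly smaller stage and before all
    those of strictly larger stage, so \<open>sep_0\<close> applies before it is switched on and
    \<open>sep_1\<close> afterwards.\<close>
  define xs where "xs = sort_key st ys"
  have xs: "set xs = P" "distinct xs" "sorted (map st xs)" "length xs = card P"
    using ys distinct_card[OF ys(2)] by (auto simp: xs_def)
  have "C (set (take i xs)) \<subset> C (set (take (Suc i) xs))" if i: "i < card P" for i
  proof
    have Q: "set (take (Suc i) xs) = insert (xs ! i) (set (take i xs))"
      using i xs(4) by (simp add: take_Suc_conv_app_nth)
    then show "C (set (take i xs)) \<subseteq> C (set (take (Suc i) xs))"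
      by (intro mono) blast
    have c: "xs ! i \<in> P"
      using i xs by (metis nth_mem)
    have "x (xs ! i) (\<phi> t) = 0" if t: "t \<in> T (set (take i xs))" for t
    proof (rule sep_0[OF c])
      have "xs ! i \<notin> set (take i xs)"
        using xs(2,4) i by (auto simp: in_set_conv_nth nth_eq_iff_index_eq)
      then show "t (xs ! i) = 0"
        using t by (auto simp: T_def)
      fix c' assume "t c' \<noteq> 0"
      then have "c' \<in> set (take i xs)"
        using t by (auto simp: T_def)
      then obtain j where "j < i" "c' = xs ! j"
        using i xs(4) by (auto simp: in_set_conv_nth)
      then show "st c' \<le> st (xs ! i)"
        using sorted_nth_mono[OF xs(3), of j i] i xs(4) by simp
    qed
    then have xI: "x (xs ! i) \<in> I (set (take i xs))"
      using sep[OF c] by (simp add: I_def)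
    obtain t where t: "\<And>c'. t c' \<noteq> 0 \<Longrightarrow> c' = xs ! i \<or> c' \<in> P \<and> st c' < st (xs ! i)"
      "x (xs ! i) (\<phi> t) \<noteq> 0"
      using sep_1[OF c] by blast
    have "t \<in> T (set (take (Suc i) xs))"
      unfolding T_def Q
    proof (intro CollectI allI impI)
      fix c' assume c': "t c' \<noteq> 0"
      show "c' \<in> insert (xs ! i) (set (take i xs))"
      proof (cases "c' = xs ! i")
        case False
        then have "c' \<in> set xs" "st c' < st (xs ! i)"
          using t(1)[OF c'] xs(1) by auto
        then obtain j where j: "j < length xs" "c' = xs ! j"
          by (auto simp: in_set_conv_nth)
        have "j < i"
        proof (rule ccontr)
          assume "\<not> j < i"
          then have "st (xs ! i) \<le> st c'"
            using sorted_nth_mono[OF xs(3), of i j] j by simp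
          then show False
            using \<open>st c' < st (xs ! i)\<close> by simp
        qed
        then show ?thesis
          using j by (auto simp: in_set_conv_nth intro!: exI[of _ j])
      qed simp
    qed
    then have "\<phi> t \<in> cone (C (set (take (Suc i) xs)))"
      by (rule mem)
    moreover have "\<phi> t \<notin> cone (C (set (take i xs)))"
      using mem_cone_zeros[OF I, of "\<phi> t" "set (take i xs)" Y] xI t(2) by (auto simp: C_def)
    ultimately show "C (set (take i xs)) \<noteq> C (set (take (Suc i) xs))"
      by auto
  qed
  then show ?thesis
    using irr by (intro exI[of _ "\<lambda>i. C (set (take i xs))"]) blast
qed

end


section \<open>Coordinates that diagonalise the equations\<close>

type_synonym ('m, 'n) point =
  "((complex^'n^'m) \<times> (complex^'n^'m)) \<times> ((complex^'m^'m) \<times> (complex^'m^'m))"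

text \<open>Coordinates of \<open>U - \<i>V\<close>, \<open>U + \<i>V\<close> and \<open>X + \<i>Y\<close>. With \<open>a\<^sub>n\<close>, \<open>b\<^sub>n\<close> the columns of the first two and
  \<open>Z\<close> the third, the \<open>n\<close>th equation of the variety reads \<open>a\<^sub>n\<^sup>T Z b\<^sub>n = 0\<close>.\<close>

datatype ('m, 'n) coord = Ca 'm 'n | Cb 'm 'n | Cz 'm 'm

fun cf :: "('m, 'n) coord \<Rightarrow> ('m::finite, 'n::finite) point \<Rightarrow> complex" where
  "cf (Ca i n) ((U, V), (X, Y)) = U $ i $ n - \<i> * V $ i $ n"
| "cf (Cb i n) ((U, V), (X, Y)) = U $ i $ n + \<i> * V $ i $ n"
| "cf (Cz i j) ((U, V), (X, Y)) = X $ i $ j + \<i> * Y $ i $ j"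

lemma cmat_scale_nth [simp]: "cmat_scale c A $ i $ j = c * A $ i $ j"
  by (simp add: cmat_scale_def)

lemma vector_space_prod_cmat_scale: "vector_space_prod cmat_scale cmat_scale"
  by (intro vector_space_prod.intro vector_space_pair.intro vector_space_cmat_scale)

lemma cmat_pair_scale_Pair: "cmat_pair_scale c (A, B) = (cmat_scale c A, cmat_scale c B)"
proof -
  interpret vector_space_prod cmat_scale cmat_scale
    by (rule vector_space_prod_cmat_scale)
  show ?thesis
    by (simp add: cmat_pair_scale_def scale_def)
qed

global_interpretation BB: biprojective
  "cmat_pair_scale :: complex \<Rightarrow> (complex^'n::finite^'m::finite) \<times> (complex^'n^'m) \<Rightarrow> _"
  "cmat_pair_scale :: complex \<Rightarrow> (complex^'m::finite^'m) \<times> (complex^'m^'m) \<Rightarrow> _" UNIV sym_skew_pairs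
  by (intro biprojective.intro vector_space_cmat_pair_scale)

abbreviation point_scale :: "complex \<Rightarrow> ('m::finite, 'n::finite) point \<Rightarrow> ('m, 'n) point" where
  "point_scale \<equiv> module_prod.scale cmat_pair_scale cmat_pair_scale"

lemma vector_space_prod_cmat_pair_scale: "vector_space_prod cmat_pair_scale cmat_pair_scale"
  by (intro vector_space_prod.intro vector_space_pair.intro vector_space_cmat_pair_scale)

lemma point_scale_Pair: "point_scale c ((U, V), (X, Y))
  = ((cmat_scale c U, cmat_scale c V), (cmat_scale c X, cmat_scale c Y))"
proof -
  interpret vector_space_prod cmat_pair_scale cmat_pair_scale
    by (rule vector_space_prod_cmat_pair_scale)
  show ?thesis
    by (simp add: scale_def cmat_pair_scale_Pair)
qed

lemma linear_cf:
  fixes c :: "('m::finite, 'n::finite) coord"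
  shows "Vector_Spaces.linear point_scale (*) (cf c)"
proof -
  interpret VW: vector_space_prod cmat_pair_scale cmat_pair_scale
    by (rule vector_space_prod_cmat_pair_scale)
  interpret vector_space "(*) :: complex \<Rightarrow> _"
    by unfold_locales (auto simp: algebra_simps)
  show ?thesis
  proof unfold_locales
    fix x y :: "('m, 'n) point" and r :: complex
    obtain U V X Y U' V' X' Y' where "x = ((U, V), (X, Y))" "y = ((U', V'), (X', Y'))"
      by (metis prod.exhaust)
    then show "cf c (x + y) = cf c x + cf c y" "cf c (point_scale r x) = r * cf c x"
      by (cases c; simp add: point_scale_Pair algebra_simps)+
  qed
qed

lemma cf_scale:
  "cf (Ca i n) (cmat_pair_scale a v, cmat_pair_scale b w) = a * cf (Ca i n) (v, w)"
  "cf (Cb i n) (cmat_pair_scale a v, cmat_pair_scale b w) = a * cf (Cb i n) (v, w)"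
  "cf (Cz j k) (cmat_pair_scale a v, cmat_pair_scale b w) = b * cf (Cz j k) (v, w)"
  by (cases v; cases w; simp add: cmat_pair_scale_Pair algebra_simps)+

lemma bihomogeneous_cf: "bihomogeneous cmat_pair_scale cmat_pair_scale (cf c)"
proof -
  have "\<exists>d e. \<forall>a b v w. cf c (cmat_pair_scale a v, cmat_pair_scale b w) = a ^ d * b ^ e * cf c (v, w)"
  proof (cases c)
    case (Ca i n)
    then show ?thesis
      by (intro exI[of _ 1] exI[of _ 0]) (simp add: cf_scale)
  next
    case (Cb i n)
    then show ?thesis
      by (intro exI[of _ 1] exI[of _ 0]) (simp add: cf_scale)
  next
    case (Cz i j)
    then show ?thesis
      by (intro exI[of _ 0] exI[of _ 1]) (simp add: cf_scale)
  qed
  then show ?thesis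
    unfolding bihomogeneous_def using complex_poly_fun.linear[OF linear_cf] by blast
qed

section \<open>Polynomial functions of matrix entries\<close>

lemma linear_cmat_scaleI:
  fixes g :: "complex^'n::finite^'m::finite \<Rightarrow> complex"
  assumes "\<And>A B. g (A + B) = g A + g B" "\<And>c A. g (cmat_scale c A) = c * g A"
  shows "Vector_Spaces.linear cmat_scale (*) g"
proof -
  interpret vector_space "cmat_scale :: complex \<Rightarrow> complex^'n^'m \<Rightarrow> _"
    by (rule vector_space_cmat_scale)
  interpret vector_space "(*) :: complex \<Rightarrow> _"
    by unfold_locales (auto simp: algebra_simps)
  show ?thesis
    by unfold_locales (auto simp: assms)
qed

lemma linear_matrix_eq_sum:
  fixes g :: "complex^'n::finite^'m::finite \<Rightarrow> complex"
  assumes "Vector_Spaces.linear cmat_scale (*) g"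
  shows "\<exists>c. \<forall>A. g A = (\<Sum>i\<in>UNIV. \<Sum>n\<in>UNIV. c i n * A $ i $ n)"
proof (intro exI allI)
  fix A
  interpret g: Vector_Spaces.linear cmat_scale "(*)" g
    by fact
  let ?E = "\<lambda>i n. (\<chi> k l. if k = i \<and> l = n then 1 else 0) :: complex^'n^'m"
  have "A = (\<Sum>i\<in>UNIV. \<Sum>n\<in>UNIV. cmat_scale (A $ i $ n) (?E i n))"
  proof (simp add: vec_eq_iff, intro allI)
    fix k l
    have "(\<Sum>n\<in>UNIV. A $ i $ n * (if k = i \<and> l = n then 1 else 0)) = (if k = i then A $ i $ l else 0)" for i
      by (simp add: if_distrib[of "(*) _"] cong: if_cong)
    then show "A $ k $ l = (\<Sum>i\<in>UNIV. \<Sum>n\<in>UNIV. A $ i $ n * (if k = i \<and> l = n then 1 else 0))"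
      by simp
  qed
  then have "g A = g (\<Sum>i\<in>UNIV. \<Sum>n\<in>UNIV. cmat_scale (A $ i $ n) (?E i n))"
    by simp
  also have "\<dots> = (\<Sum>i\<in>UNIV. \<Sum>n\<in>UNIV. g (?E i n) * A $ i $ n)"
    by (simp add: g.sum g.scale mult.commute)
  finally show "g A = (\<Sum>i\<in>UNIV. \<Sum>n\<in>UNIV. g (?E i n) * A $ i $ n)" .
qed

text \<open>A linear functional is a combination of matrix entries, so constants, sums and products
  of entries yield all polynomial functions. The substitution \<gamma> serves two uses: the identity
  for rationality on a piece, and the image of a line for polynomial dependence on its
  parameter.\<close>

lemma complex_poly_fun_point_induct:
  fixes f :: "('m::finite, 'n::finite) point \<Rightarrow> complex"
  assumes f: "complex_poly_fun point_scale f"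
    and const: "\<And>c. R (\<lambda>s. c)"
    and add: "\<And>g h. R g \<Longrightarrow> R h \<Longrightarrow> R (\<lambda>s. g s + h s)"
    and mult: "\<And>g h. R g \<Longrightarrow> R h \<Longrightarrow> R (\<lambda>s. g s * h s)"
    and U: "\<And>i n. R (\<lambda>s. fst (fst (\<gamma> s)) $ i $ n)"
    and V: "\<And>i n. R (\<lambda>s. snd (fst (\<gamma> s)) $ i $ n)"
    and X: "\<And>i j. R (\<lambda>s. fst (snd (\<gamma> s)) $ i $ j)"
    and Y: "\<And>i j. R (\<lambda>s. snd (snd (\<gamma> s)) $ i $ j)"
  shows "R (\<lambda>s. f (\<gamma> s))"
  using f
proof induction
  case (linear f)
  then interpret f: Vector_Spaces.linear point_scale "(*)" f .
  have sum: "R (\<lambda>s. \<Sum>i\<in>I. g i s)" if "\<And>i. R (g i)" for I :: "'x set" and g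
    by (induction I rule: infinite_finite_induct) (auto intro: const add that)
  define g1 where "g1 = (\<lambda>A. f ((A, 0), (0, 0)))"
  define g2 where "g2 = (\<lambda>A. f ((0, A), (0, 0)))"
  define g3 where "g3 = (\<lambda>A. f ((0, 0), (A, 0)))"
  define g4 where "g4 = (\<lambda>A. f ((0, 0), (0, A)))"
  have s0: "cmat_scale c 0 = (0 :: complex^'k::finite^'l::finite)" for c
    by (simp add: vec_eq_iff)
  note defs = g1_def g2_def g3_def g4_def point_scale_Pair s0
  have g1: "Vector_Spaces.linear cmat_scale (*) g1"
  proof (rule linear_cmat_scaleI)
    show "g1 (A + B) = g1 A + g1 B" for A B
      using f.add[of "((A, 0), (0, 0))" "((B, 0), (0, 0))"] by (simp add: defs)
    show "g1 (cmat_scale c A) = c * g1 A" for c A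
      using f.scale[of c "((A, 0), (0, 0))"] by (simp add: defs)
  qed
  have g2: "Vector_Spaces.linear cmat_scale (*) g2"
  proof (rule linear_cmat_scaleI)
    show "g2 (A + B) = g2 A + g2 B" for A B
      using f.add[of "((0, A), (0, 0))" "((0, B), (0, 0))"] by (simp add: defs)
    show "g2 (cmat_scale c A) = c * g2 A" for c A
      using f.scale[of c "((0, A), (0, 0))"] by (simp add: defs)
  qed
  have g3: "Vector_Spaces.linear cmat_scale (*) g3"
  proof (rule linear_cmat_scaleI)
    show "g3 (A + B) = g3 A + g3 B" for A B
      using f.add[of "((0, 0), (A, 0))" "((0, 0), (B, 0))"] by (simp add: defs)
    show "g3 (cmat_scale c A) = c * g3 A" for c A
      using f.scale[of c "((0, 0), (A, 0))"] by (simp add: defs)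
  qed
  have g4: "Vector_Spaces.linear cmat_scale (*) g4"
  proof (rule linear_cmat_scaleI)
    show "g4 (A + B) = g4 A + g4 B" for A B
      using f.add[of "((0, 0), (0, A))" "((0, 0), (0, B))"] by (simp add: defs)
    show "g4 (cmat_scale c A) = c * g4 A" for c A
      using f.scale[of c "((0, 0), (0, A))"] by (simp add: defs)
  qed
  obtain c1 where c1: "\<forall>A. g1 A = (\<Sum>i\<in>UNIV. \<Sum>n\<in>UNIV. c1 i n * A $ i $ n)"
    using linear_matrix_eq_sum[OF g1] ..
  obtain c2 where c2: "\<forall>A. g2 A = (\<Sum>i\<in>UNIV. \<Sum>n\<in>UNIV. c2 i n * A $ i $ n)"
    using linear_matrix_eq_sum[OF g2] ..
  obtain c3 where c3: "\<forall>A. g3 A = (\<Sum>i\<in>UNIV. \<Sum>n\<in>UNIV. c3 i n * A $ i $ n)"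
    using linear_matrix_eq_sum[OF g3] ..
  obtain c4 where c4: "\<forall>A. g4 A = (\<Sum>i\<in>UNIV. \<Sum>n\<in>UNIV. c4 i n * A $ i $ n)"
    using linear_matrix_eq_sum[OF g4] ..
  have "f (\<gamma> s) = g1 (fst (fst (\<gamma> s))) + g2 (snd (fst (\<gamma> s)))
      + (g3 (fst (snd (\<gamma> s))) + g4 (snd (snd (\<gamma> s))))" for s
  proof -
    obtain U V X Y where s: "\<gamma> s = ((U, V), (X, Y))"
      by (metis prod.exhaust)
    have "f ((U, V), (X, Y)) = f (((U, 0), (0, 0)) + ((0, V), (0, 0)) + (((0, 0), (X, 0)) + ((0, 0), (0, Y))))"
      by simp
    also have "\<dots> = g1 U + g2 V + (g3 X + g4 Y)"
      unfolding f.add by (simp add: defs)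
    finally show ?thesis
      by (simp add: s)
  qed
  then show ?case
    unfolding c1[rule_format] c2[rule_format] c3[rule_format] c4[rule_format]
    by (simp only:) (intro add sum mult const U V X Y)
qed (auto intro: const add mult)

section \<open>The equations and the rank condition in the new coordinates\<close>

lemma bilin_transpose: "bilin x A y = bilin y (transpose A) x"
  unfolding bilin_def by (subst sum.swap) (simp add: transpose_def mult_ac)

lemma bilin_minus: "bilin x (- A) y = - bilin x A y"
  by (simp add: bilin_def sum_negf)

text \<open>In the expansion of the right-hand side the two mixed terms with \<open>X\<close> cancel
  by symmetry. By skew-symmetry the terms pairing \<open>u\<close> or \<open>v\<close> with itself
  through \<open>Y\<close> vanish, and the two mixed ones coincide.\<close>

lemma bilin_equation_iff:
  assumes X: "transpose X = X" and Y: "transpose Y = - Y"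
  shows "bilin u X u + bilin v X v - 2 * bilin u Y v
    = (\<Sum>i\<in>UNIV. (u $ i - \<i> * v $ i) * (\<Sum>j\<in>UNIV. (X $ i $ j + \<i> * Y $ i $ j) * (u $ j + \<i> * v $ j)))"
proof -
  have ring: "(u $ i - \<i> * v $ i) * ((X $ i $ j + \<i> * Y $ i $ j) * (u $ j + \<i> * v $ j))
      = u $ i * X $ i $ j * u $ j + v $ i * X $ i $ j * v $ j - u $ i * Y $ i $ j * v $ j
        + v $ i * Y $ i $ j * u $ j + \<i> * (u $ i * X $ i $ j * v $ j) - \<i> * (v $ i * X $ i $ j * u $ j)
        + \<i> * (u $ i * Y $ i $ j * u $ j) + \<i> * (v $ i * Y $ i $ j * v $ j)" for i j
  proof -
    have "(a - \<i> * b) * ((x + \<i> * y) * (c + \<i> * d)) = a * x * c + b * x * d - a * y * d + b * y * c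
        + \<i> * (a * x * d) - \<i> * (b * x * c) + \<i> * (a * y * c) + \<i> * (b * y * d)"
      for a b c d x y :: complex
      using i_squared by algebra
    then show ?thesis .
  qed
  have "(\<Sum>i\<in>UNIV. (u $ i - \<i> * v $ i) * (\<Sum>j\<in>UNIV. (X $ i $ j + \<i> * Y $ i $ j) * (u $ j + \<i> * v $ j)))
      = bilin u X u + bilin v X v - bilin u Y v + bilin v Y u + \<i> * bilin u X v - \<i> * bilin v X u
        + \<i> * bilin u Y u + \<i> * bilin v Y v"
    unfolding sum_distrib_left ring bilin_def sum.distrib sum_subtractf ..
  moreover have "bilin v X u = bilin u X v"
    using bilin_transpose[of v X u] by (simp add: X)
  moreover have "bilin v Y u = - bilin u Y v"
    using bilin_transpose[of v Y u] by (simp add: Y bilin_minus)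
  moreover have "bilin x Y x = 0" for x
    using bilin_transpose[of x Y x] by (simp add: Y bilin_minus)
  ultimately show ?thesis
    by simp
qed

text \<open>Entry \<open>i\<close> of the vector \<open>Z b\<^sub>n\<close>: a coefficient of the
  \<open>n\<close>th equation, read as linear in \<open>a\<^sub>n\<close>.\<close>

definition zb :: "'m \<Rightarrow> 'n \<Rightarrow> ('m::finite, 'n::finite) point \<Rightarrow> complex" where
  "zb i n x = (\<Sum>j\<in>UNIV. cf (Cz i j) x * cf (Cb j n) x)"

lemma B_cond_iff:
  assumes "Q \<in> sym_skew_pairs"
  shows "B_cond P Q \<longleftrightarrow> rank (\<chi> i j. cf (Cz i j) (P, Q)) \<le> 2 \<and>
    (\<forall>n. (\<Sum>i\<in>UNIV. cf (Ca i n) (P, Q) * zb i n (P, Q)) = 0)"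
proof -
  obtain U V X Y where PQ [simp]: "P = (U, V)" "Q = (X, Y)"
    by (cases P; cases Q)
  have "transpose X = X" "transpose Y = - Y"
    using assms by (auto simp: sym_skew_pairs_def)
  note eq = bilin_equation_iff[OF this]
  have "X + cmat_scale \<i> Y = (\<chi> i j. cf (Cz i j) (P, Q))"
    by (simp add: vec_eq_iff)
  then have "B_cond P Q \<longleftrightarrow> rank (\<chi> i j. cf (Cz i j) (P, Q)) \<le> 2 \<and>
    (\<forall>n. bilin (column n U) X (column n U) + bilin (column n V) X (column n V)
        - 2 * bilin (column n U) Y (column n V) = 0)"
    by (simp only: B_cond_def prod.case PQ)
  then show ?thesis
    unfolding eq by (simp add: zb_def column_def)
qed

text \<open>Inverts the change of coordinates: the transpose of \<open>X + \<i>Y\<close> is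
  \<open>X - \<i>Y\<close>, so \<open>X\<close> and \<open>\<i>Y\<close> are its symmetric and
  skew-symmetric parts.\<close>

lemma entries_eq_cf:
  "fst (fst x) $ i $ n = (cf (Ca i n) x + cf (Cb i n) x) / 2"
  "snd (fst x) $ i $ n = (cf (Cb i n) x - cf (Ca i n) x) / (2 * \<i>)"
  "snd x \<in> sym_skew_pairs \<Longrightarrow> fst (snd x) $ i $ j = (cf (Cz i j) x + cf (Cz j i) x) / 2"
  "snd x \<in> sym_skew_pairs \<Longrightarrow> snd (snd x) $ i $ j = (cf (Cz i j) x - cf (Cz j i) x) / (2 * \<i>)"
proof -
  obtain U V X Y where x: "x = ((U, V), (X, Y))"
    by (metis prod.exhaust)
  show "fst (fst x) $ i $ n = (cf (Ca i n) x + cf (Cb i n) x) / 2"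
    "snd (fst x) $ i $ n = (cf (Cb i n) x - cf (Ca i n) x) / (2 * \<i>)"
    by (simp_all add: x)
  assume "snd x \<in> sym_skew_pairs"
  then have "transpose X = X" "transpose Y = - Y"
    by (auto simp: x sym_skew_pairs_def)
  then have "transpose X $ i $ j = X $ i $ j" "transpose Y $ i $ j = - Y $ i $ j"
    by simp_all
  then have "X $ j $ i = X $ i $ j" "Y $ j $ i = - Y $ i $ j"
    by (simp_all add: transpose_def)
  then show "fst (snd x) $ i $ j = (cf (Cz i j) x + cf (Cz j i) x) / 2"
    "snd (snd x) $ i $ j = (cf (Cz i j) x - cf (Cz j i) x) / (2 * \<i>)"
    by (simp_all add: x)
qed

text \<open>Rows \<open>j\<close> and \<open>l\<close> are independent, the minor being nonzero, and
  so span the row space. Writing row \<open>a\<close> as their combination and eliminating the two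
  coefficients by means of the columns \<open>k\<close> and \<open>m\<close> gives the
  formula.\<close>

lemma rank_le_2_minors:
  fixes Z :: "complex^'n::finite^'m::finite"
  assumes "rank Z \<le> 2" and \<delta>: "Z $ j $ k * Z $ l $ m - Z $ j $ m * Z $ l $ k \<noteq> 0"
  shows "Z $ a $ b * (Z $ j $ k * Z $ l $ m - Z $ j $ m * Z $ l $ k)
    = Z $ j $ k * Z $ l $ b * Z $ a $ m - Z $ j $ m * Z $ l $ b * Z $ a $ k
      - Z $ j $ b * Z $ l $ k * Z $ a $ m + Z $ j $ b * Z $ l $ m * Z $ a $ k"
proof -
  have neq: "Z $ j \<noteq> Z $ l"
    using \<delta> by (auto simp: mult.commute)
  have ind: "vec.independent {Z $ j, Z $ l}"
    unfolding vec.independent_explicit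
  proof (intro conjI allI impI)
    fix c assume "(\<Sum>v\<in>{Z $ j, Z $ l}. c v *s v) = 0"
    then have 0: "c (Z $ j) *s (Z $ j) + c (Z $ l) *s (Z $ l) = 0"
      using neq by simp
    have "c (Z $ j) * Z $ j $ i + c (Z $ l) * Z $ l $ i = 0" for i
      using arg_cong[OF 0, of "\<lambda>v. v $ i"] by simp
    note this[of k] this[of m]
    then have "c (Z $ j) * (Z $ j $ k * Z $ l $ m - Z $ j $ m * Z $ l $ k) = 0"
      "c (Z $ l) * (Z $ j $ k * Z $ l $ m - Z $ j $ m * Z $ l $ k) = 0"
      by algebra+
    then show "\<forall>v\<in>{Z $ j, Z $ l}. c v = 0"
      using \<delta> by simp
  qed simp
  have row: "Z $ i \<in> rows Z" for i
    by (auto simp: rows_def row_def)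
  have "rows Z \<subseteq> vec.span {Z $ j, Z $ l}"
    using assms(1) neq row by (intro vec.card_ge_dim_independent[OF _ ind]) (auto simp: row_rank_def_gen)
  then have "Z $ a \<in> vec.span {Z $ j, Z $ l}"
    using row by blast
  then obtain \<alpha> \<beta> where "Z $ a - \<alpha> *s (Z $ j) = \<beta> *s (Z $ l)"
    by (auto simp: vec.span_breakdown_eq vec.span_singleton)
  then have "Z $ a = \<alpha> *s (Z $ j) + \<beta> *s (Z $ l)"
    by (simp add: algebra_simps)
  then have "Z $ a $ i = \<alpha> * Z $ j $ i + \<beta> * Z $ l $ i" for i
    by simp
  note this[of b] this[of k] this[of m]
  then show ?thesis
    by algebra
qed


section \<open>The upper bound\<close>

instance coord :: (finite, finite) finite
proof
  have "(UNIV :: ('a, 'b) coord set) = (\<lambda>(i, n). Ca i n) ` UNIV \<union> (\<lambda>(i, n). Cb i n) ` UNIV \<union> (\<lambda>(i, j). Cz i j) ` UNIV"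
    (is "_ = ?A")
  proof (intro equalityI subsetI)
    fix c :: "('a, 'b) coord"
    show "c \<in> ?A"
      by (cases c) auto
  qed simp
  then show "finite (UNIV :: ('a, 'b) coord set)"
    by (metis finite_UN_I finite_Un finite_imageI finite)
qed

text \<open>The coordinate for which the \<open>n\<close>th equation is solved: \<open>a\<^sub>i\<^sub>n\<close> if the \<open>i\<close>th entry of \<open>Z b\<^sub>n\<close> is
  nonzero; if \<open>Z b\<^sub>n = 0\<close>, one row of this linear system is solved for \<open>b\<^sub>k\<^sub>n\<close>.\<close>

definition solved :: "'m \<Rightarrow> ('n \<Rightarrow> 'm option) \<Rightarrow> 'n \<Rightarrow> ('m, 'n) coord" where
  "solved k sel n = (case sel n of Some i \<Rightarrow> Ca i n | None \<Rightarrow> Cb k n)"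

definition minor :: "'m \<Rightarrow> 'm \<Rightarrow> 'm \<Rightarrow> 'm \<Rightarrow> ('m::finite, 'n::finite) point \<Rightarrow> complex" where
  "minor j k l m x = cf (Cz j k) x * cf (Cz l m) x - cf (Cz j m) x * cf (Cz l k) x"

text \<open>The equation for \<open>Some (l, m)\<close> is the vanishing of the minor of \<open>Z\<close> with rows \<open>j\<close>, \<open>l\<close>, \<open>a\<close> and
  columns \<open>k\<close>, \<open>m\<close>, \<open>b\<close>, and the one for \<open>None\<close> that of the minor with rows \<open>j\<close>, \<open>a\<close> and columns \<open>k\<close>, \<open>b\<close>.\<close>

definition Z_cond :: "'m \<Rightarrow> 'm \<Rightarrow> ('m \<times> 'm) option \<Rightarrow> ('m::finite, 'n::finite) point \<Rightarrow> bool" where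
  "Z_cond j k lm x \<longleftrightarrow> (case lm of
     None \<Rightarrow> (\<forall>a b. cf (Cz j k) x * cf (Cz a b) x = cf (Cz j b) x * cf (Cz a k) x)
   | Some (l, m) \<Rightarrow> minor j k l m x \<noteq> 0 \<and>
       (\<forall>a b. cf (Cz a b) x * minor j k l m x
         = cf (Cz j k) x * cf (Cz l b) x * cf (Cz a m) x - cf (Cz j m) x * cf (Cz l b) x * cf (Cz a k) x
           - cf (Cz j b) x * cf (Cz l k) x * cf (Cz a m) x + cf (Cz j b) x * cf (Cz l m) x * cf (Cz a k) x))"

text \<open>Of the system \<open>Z b\<^sub>n = 0\<close> only row \<open>j\<close> is kept, where
  the coefficient of \<open>b\<^sub>k\<^sub>n\<close> is the entry of \<open>Z\<close> that is
  nonzero on the piece. The pieces may thereby exceed the variety, which is harmless for an upper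
  bound.\<close>

definition columns_cond :: "'m \<Rightarrow> ('n \<Rightarrow> 'm option) \<Rightarrow> ('m::finite, 'n::finite) point \<Rightarrow> bool" where
  "columns_cond j sel x \<longleftrightarrow> (\<forall>n. case sel n of
     None \<Rightarrow> zb j n x = 0
   | Some i \<Rightarrow> zb i n x \<noteq> 0 \<and> (\<Sum>i\<in>UNIV. cf (Ca i n) x * zb i n x) = 0)"

definition piece_cond :: "'m \<Rightarrow> 'm \<Rightarrow> ('m \<times> 'm) option \<Rightarrow> ('n \<Rightarrow> 'm option) \<Rightarrow> ('m::finite, 'n::finite) point \<Rightarrow> bool"
  where
  "piece_cond j k lm sel x \<longleftrightarrow>
     snd x \<in> sym_skew_pairs \<and> cf (Cz j k) x \<noteq> 0 \<and> Z_cond j k lm x \<and> columns_cond j sel x"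

lemma piece_cond_sel:
  assumes "piece_cond j k lm sel x"
  shows "case sel n of
        None \<Rightarrow> zb j n x = 0
      | Some i \<Rightarrow> zb i n x \<noteq> 0 \<and> (\<Sum>i\<in>UNIV. cf (Ca i n) x * zb i n x) = 0"
  using assms unfolding piece_cond_def columns_cond_def by blast

definition AB :: "('m, 'n) coord set" where
  "AB = {c. \<forall>i j. c \<noteq> Cz i j}"

text \<open>The two normalisations to 1 use up the scalings of the two projective factors. The
  coordinate \<open>c\<close> is not a solved one, so its normalisation lowers the number of free
  coordinates.\<close>

definition piece ::
  "('m \<times> 'm) \<times> ('m \<times> 'm) option \<times> ('n \<Rightarrow> 'm option) \<times> ('m, 'n) coord \<Rightarrow> ('m::finite, 'n::finite) point set" where
  "piece = (\<lambda>((j, k), lm, sel, c). {x. piece_cond j k lm sel x \<and> cf (Cz j k) x = 1 \<and> cf c x = 1 \<and>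
     c \<in> AB - range (solved k sel)})"

text \<open>Coordinates for matrices of rank two whose minor on rows \<open>j\<close>,
  \<open>l\<close> and columns \<open>k\<close>, \<open>m\<close> is nonzero, with the entry at
  \<open>(j, k)\<close> normalised.\<close>

definition Z_params :: "'m \<Rightarrow> 'm \<Rightarrow> 'm \<Rightarrow> 'm \<Rightarrow> ('m, 'n) coord set" where
  "Z_params j k l m = {Cz a b | a b. (a \<in> {j, l} \<or> b \<in> {k, m}) \<and> (a, b) \<noteq> (j, k)}"

text \<open>Two rows and two columns share four entries, and one entry is normalised: 2M + 2M - 4 -
  1.\<close>

lemma card_Z_params:
  assumes "j \<noteq> l" "k \<noteq> m"
  shows "card (Z_params j k l m :: ('m::finite, 'n::finite) coord set) + 5 = 4 * CARD('m)"
proof -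
  let ?R = "{j, l} \<times> (UNIV :: 'm set)" and ?C = "(UNIV :: 'm set) \<times> {k, m}"
  have img: "(Z_params j k l m :: ('m, 'n) coord set) = (\<lambda>(a, b). Cz a b) ` (?R \<union> ?C - {(j, k)} :: ('m \<times> 'm) set)"
    by (auto simp: Z_params_def)
  have "inj (\<lambda>(a, b). Cz a b :: ('m, 'n) coord)"
    by (auto simp: inj_def)
  then have "card (Z_params j k l m :: ('m, 'n) coord set) = card (?R \<union> ?C - {(j, k)})"
    unfolding img by (intro card_image) (erule inj_on_subset, rule subset_UNIV)
  moreover have "Suc (card (?R \<union> ?C - {(j, k)})) = card (?R \<union> ?C)"
    by (rule card_Suc_Diff1) simp_all
  moreover have "?R \<inter> ?C = {j, l} \<times> {k, m}"
    by auto
  then have "card (?R \<union> ?C) + 4 = 4 * CARD('m)"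
    using card_Un_Int[of ?R ?C] assms by (simp add: card_cartesian_product)
  ultimately show ?thesis
    by linarith
qed

lemma card_AB: "card (AB :: ('m::finite, 'n::finite) coord set) = 2 * CARD('m) * CARD('n)"
proof -
  let ?A = "(\<lambda>(i, n). Ca i n) ` UNIV :: ('m, 'n) coord set"
  let ?B = "(\<lambda>(i, n). Cb i n) ` UNIV :: ('m, 'n) coord set"
  have "AB = ?A \<union> ?B"
  proof (intro equalityI subsetI)
    fix c :: "('m, 'n) coord" assume "c \<in> AB"
    then show "c \<in> ?A \<union> ?B"
      by (cases c) (auto simp: AB_def)
  qed (auto simp: AB_def)
  moreover have "card ?A = CARD('m) * CARD('n)" "card ?B = CARD('m) * CARD('n)"
    by (simp_all add: card_image inj_on_def case_prod_beta prod_eq_iff)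
  moreover have "?A \<inter> ?B = {}"
    by auto
  ultimately show ?thesis
    using card_Un_disjoint[of ?A ?B] by simp
qed

lemma inj_solved: "inj (solved k sel)"
  by (auto simp: inj_def solved_def split: option.splits)

lemma solved_AB: "range (solved k sel) \<subseteq> AB"
  by (auto simp: AB_def solved_def split: option.splits)

lemma ratfun_point:
  fixes f :: "('m::finite, 'n::finite) point \<Rightarrow> complex"
  assumes S: "\<And>x. x \<in> S \<Longrightarrow> snd x \<in> sym_skew_pairs"
    and cf: "\<And>c. cf c \<in> ratfun T S"
    and f: "complex_poly_fun point_scale f"
  shows "f \<in> ratfun T S"
proof -
  have half: "(\<lambda>x. (cf c x + cf c' x) / 2) \<in> ratfun T S"
    "(\<lambda>x. (cf c x - cf c' x) / (2 * \<i>)) \<in> ratfun T S" for c c'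
    using ratfun_divide[OF ratfun_add[OF cf cf] ratfun_const[of 2]]
      ratfun_divide[OF ratfun_add[OF cf ratfun_minus[OF cf]] ratfun_const[of "2 * \<i>"]] by auto
  show ?thesis
  proof (rule complex_poly_fun_point_induct[OF f, of "\<lambda>g. g \<in> ratfun T S" "\<lambda>x. x"])
    fix i j
    show "(\<lambda>x. fst (snd x) $ i $ j) \<in> ratfun T S"
      by (rule ratfun_cong[OF half(1)]) (simp add: entries_eq_cf(3) S)
    show "(\<lambda>x. snd (snd x) $ i $ j) \<in> ratfun T S"
      by (rule ratfun_cong[OF half(2)]) (simp add: entries_eq_cf(4) S)
  next
    fix i n
    show "(\<lambda>x. fst (fst x) $ i $ n) \<in> ratfun T S"
      unfolding entries_eq_cf(1) by (rule half(1))
    show "(\<lambda>x. snd (fst x) $ i $ n) \<in> ratfun T S"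
      unfolding entries_eq_cf(2) by (rule half(2))
  qed (intro ratfun_const ratfun_add ratfun_mult; assumption)+
qed

text \<open>The coordinates are recovered in the order \<open>Z\<close>, \<open>b\<^sub>n\<close>,
  \<open>Z b\<^sub>n\<close>, \<open>a\<^sub>n\<close>. The generators are 4M - 5 entries of
  \<open>Z\<close> and 2MN - N - 1 entries of the \<open>a\<^sub>n\<close> and
  \<open>b\<^sub>n\<close>, N of these being solved for and one normalised.\<close>

lemma growth_le_piece:
  fixes idx :: "('m::finite \<times> 'm) \<times> ('m \<times> 'm) option \<times> ('n::finite \<Rightarrow> 'm option) \<times> ('m, 'n) coord"
  assumes M: "CARD('m) \<ge> 2"
    and D: "D + CARD('n) + 6 = 2 * CARD('m) * CARD('n) + 4 * CARD('m)"
  shows "growth_le D {f. complex_poly_fun point_scale f} (piece idx)"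
proof (cases "piece idx = {}")
  case True
  then show ?thesis
    by (simp add: growth_le_empty)
next
  case False
  obtain j k lm sel c where idx: "idx = ((j, k), lm, sel, c)"
    by (metis prod.exhaust)
  let ?S = "piece idx"
  have S: "snd x \<in> sym_skew_pairs" "cf (Cz j k) x = 1" "cf c x = 1" "piece_cond j k lm sel x"
    if "x \<in> ?S" for x
    using that by (auto simp: piece_def idx piece_cond_def)
  have c: "c \<in> AB - range (solved k sel)"
    using False by (auto simp: piece_def idx)
  have other: "\<exists>b. b \<noteq> a" for a :: 'm
  proof (rule ccontr)
    assume "\<not> ?thesis"
    then have "(UNIV :: 'm set) = {a}"
      by auto
    then have "CARD('m) = 1"
      by (metis card_1_singleton_iff One_nat_def)
    then show False
      using M by simp
  qed
  \<comment> \<open>In the rank one case any other row and column will do: row \<open>j\<close> and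
    column \<open>k\<close> already determine \<open>Z\<close>, and additional generators within the
    count do no harm.\<close>
  have "\<exists>l m. l \<noteq> j \<and> m \<noteq> k \<and> (lm = None \<or> lm = Some (l, m))"
  proof (cases lm)
    case None
    then show ?thesis
      using other[of j] other[of k] by auto
  next
    case (Some p)
    obtain l m where p: "p = (l, m)"
      by (cases p)
    obtain x where "x \<in> ?S"
      using False by blast
    then have "minor j k l m x \<noteq> 0"
      using S(4) unfolding piece_cond_def Z_cond_def Some p option.case prod.case by blast
    then have "l \<noteq> j" "m \<noteq> k"
      by (auto simp: minor_def mult.commute)
    then show ?thesis
      by (auto simp: Some p)
  qed
  then obtain l m where lm: "l \<noteq> j" "m \<noteq> k" "lm = None \<or> lm = Some (l, m)"
    by blast
  define Q where "Q = Z_params j k l m \<union> (AB - range (solved k sel) - {c})"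
  define T where "T = cf ` Q"
  have T: "finite T"
    by (simp add: T_def)
  have gen: "cf d \<in> ratfun T ?S" if "d \<in> Q" for d
    using that by (intro ratfun_gen T) (simp add: T_def)
  have Zjk: "cf (Cz j k) \<in> ratfun T ?S"
    by (rule ratfun_cong[OF ratfun_const[of 1]]) (simp add: S)
  have Z1: "cf (Cz a b) \<in> ratfun T ?S" if "a \<in> {j, l} \<or> b \<in> {k, m}" for a b
  proof (cases "(a, b) = (j, k)")
    case False
    then show ?thesis
      using that unfolding Q_def Z_params_def by (intro gen[unfolded Q_def Z_params_def]) blast
  next
    case True
    then show ?thesis
      using Zjk by simp
  qed
  have Z: "cf (Cz a b) \<in> ratfun T ?S" for a b
    using lm(3)
  proof
    assume lm: "lm = None"
    have "cf (Cz j k) x * cf (Cz a b) x = cf (Cz j b) x * cf (Cz a k) x" if "x \<in> ?S" for x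
      using S(4)[OF that] unfolding piece_cond_def Z_cond_def lm option.case by blast
    then have eq: "cf (Cz a b) x = cf (Cz j b) x * cf (Cz a k) x" if "x \<in> ?S" for x
      using S(2)[OF that] that by (metis mult_1)
    have "(\<lambda>x. cf (Cz j b) x * cf (Cz a k) x) \<in> ratfun T ?S"
      by (intro ratfun_mult Z1) auto
    then show ?thesis
      by (rule ratfun_cong) (rule eq)
  next
    assume lm: "lm = Some (l, m)"
    define r where "r = (\<lambda>x :: ('m, 'n) point.
      cf (Cz j k) x * cf (Cz l b) x * cf (Cz a m) x - cf (Cz j m) x * cf (Cz l b) x * cf (Cz a k) x
              - cf (Cz j b) x * cf (Cz l k) x * cf (Cz a m) x + cf (Cz j b) x * cf (Cz l m) x * cf (Cz a k) x)"
    have minor: "minor j k l m x \<noteq> 0" "cf (Cz a b) x * minor j k l m x = r x" if "x \<in> ?S" for x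
      using S(4)[OF that] unfolding piece_cond_def Z_cond_def lm option.case prod.case r_def by blast+
    have "r \<in> ratfun T ?S"
      unfolding r_def diff_conv_add_uminus
      by (intro ratfun_add ratfun_minus ratfun_mult Z1) auto
    moreover have "minor j k l m \<in> ratfun T ?S"
      unfolding minor_def[abs_def] diff_conv_add_uminus
      by (intro ratfun_add ratfun_minus ratfun_mult Z1) auto
    ultimately have "(\<lambda>x. r x / minor j k l m x) \<in> ratfun T ?S"
      by (rule ratfun_divide) (rule minor(1))
    then show ?thesis
      by (rule ratfun_cong) (simp add: minor nonzero_eq_divide_eq)
  qed
  have free: "cf d \<in> ratfun T ?S" if "d \<in> AB" "d \<notin> range (solved k sel)" for d
  proof (cases "d = c")
    case True
    show ?thesis
      by (rule ratfun_cong[OF ratfun_const[of 1]]) (simp add: True S)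
  next
    case False
    then show ?thesis
      using that by (intro gen) (auto simp: Q_def)
  qed
  have B1: "cf (Cb i n) \<in> ratfun T ?S" if "i \<noteq> k \<or> sel n \<noteq> None" for i n
    using that by (intro free) (auto simp: AB_def solved_def split: option.splits)
  have B: "cf (Cb i n) \<in> ratfun T ?S" for i n
  proof (cases "i \<noteq> k \<or> sel n \<noteq> None")
    case False
    \<comment> \<open>Row \<open>j\<close> of \<open>Z b\<^sub>n = 0\<close>, solved for the entry
      whose coefficient is normalised to 1.\<close>
    have eq: "cf (Cb k n) x = (\<Sum>i\<in>UNIV - {k}. - (cf (Cz j i) x * cf (Cb i n) x))" if x: "x \<in> ?S" for x
    proof -
      have "zb j n x = 0"
        using piece_cond_sel[OF S(4)[OF x], of n] False by simp
      then show ?thesis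
        using S(2)[OF x] by (simp add: zb_def sum.remove[of _ k] sum_negf add_eq_0_iff2)
    qed
    have "(\<lambda>x. \<Sum>i\<in>UNIV - {k}. - (cf (Cz j i) x * cf (Cb i n) x)) \<in> ratfun T ?S"
      by (intro ratfun_sum ratfun_minus ratfun_mult Z B1) auto
    then have "cf (Cb k n) \<in> ratfun T ?S"
      by (rule ratfun_cong) (rule eq)
    then show ?thesis
      using False by simp
  qed (rule B1)
  have zb: "zb i n \<in> ratfun T ?S" for i n
    unfolding zb_def[abs_def] by (intro ratfun_sum ratfun_mult Z B)
  have A1: "cf (Ca i n) \<in> ratfun T ?S" if "sel n \<noteq> Some i" for i n
    using that by (intro free) (auto simp: AB_def solved_def split: option.splits)
  have A: "cf (Ca i n) \<in> ratfun T ?S" for i n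
  proof (cases "sel n = Some i")
    case True
    have zb0: "zb i n x \<noteq> 0"
      and A0: "(\<Sum>i\<in>UNIV. cf (Ca i n) x * zb i n x) = 0" if "x \<in> ?S" for x
      using piece_cond_sel[OF S(4)[OF that], of n] True by simp_all
    have eq: "cf (Ca i n) x = (\<Sum>i'\<in>UNIV - {i}. - (cf (Ca i' n) x * zb i' n x)) / zb i n x" if x: "x \<in> ?S" for x
    proof -
      have "cf (Ca i n) x * zb i n x = (\<Sum>i'\<in>UNIV - {i}. - (cf (Ca i' n) x * zb i' n x))"
        using A0[OF x] by (simp add: sum.remove[of _ i] sum_negf add_eq_0_iff2)
      then show ?thesis
        by (simp only: nonzero_eq_divide_eq[OF zb0[OF x]])
    qed
    have "(\<lambda>x. (\<Sum>i'\<in>UNIV - {i}. - (cf (Ca i' n) x * zb i' n x)) / zb i n x) \<in> ratfun T ?S"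
      using True by (intro ratfun_divide ratfun_sum ratfun_minus ratfun_mult zb A1 zb0) auto
    then show ?thesis
      by (rule ratfun_cong) (rule eq)
  qed (rule A1)
  have cf: "cf d \<in> ratfun T ?S" for d
    using A B Z by (cases d) simp_all
  have "{f. complex_poly_fun point_scale f} \<subseteq> ratfun T ?S"
    using ratfun_point[of ?S T, OF S(1) cf] by blast
  moreover have "card T \<le> D"
  proof -
    have "card T \<le> card (Z_params j k l m :: ('m, 'n) coord set) + card (AB - range (solved k sel) - {c})"
      unfolding T_def Q_def by (intro order_trans[OF card_image_le card_Un_le]) simp
    moreover have "Suc (card (AB - range (solved k sel) - {c})) = card (AB - range (solved k sel))"
      using c by (intro card_Suc_Diff1) simp_all
    moreover have "card (AB - range (solved k sel)) + CARD('n) = card (AB :: ('m, 'n) coord set)"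
      using card_Diff_subset[OF _ solved_AB[of k sel]] card_mono[OF _ solved_AB[of k sel]]
        card_image[OF inj_solved[of k sel]] by simp
    moreover have "card (Z_params j k l m :: ('m, 'n) coord set) + 5 = 4 * CARD('m)"
      using lm by (intro card_Z_params) auto
    ultimately show ?thesis
      using D card_AB[where 'm = 'm and 'n = 'n] by linarith
  qed
  ultimately show ?thesis
    by (intro growth_le_ratfun[OF T])
qed

section \<open>Covering the variety by pieces, up to scaling\<close>

lemma zb_scale: "zb i n (cmat_pair_scale a v, cmat_pair_scale b w) = b * a * zb i n (v, w)"
  by (simp add: zb_def cf_scale sum_distrib_left mult_ac)

lemma minor_scale: "minor j k l m (cmat_pair_scale a v, cmat_pair_scale b w) = b\<^sup>2 * minor j k l m (v, w)"
  by (simp add: minor_def cf_scale power2_eq_square algebra_simps)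

lemma sym_skew_pairs_scale: "w \<in> sym_skew_pairs \<Longrightarrow> cmat_pair_scale b w \<in> sym_skew_pairs"
proof -
  have "transpose (cmat_scale b A) = cmat_scale b (transpose A)"
    "cmat_scale b (- A) = - cmat_scale b A" for A :: "complex^'a^'a"
    by (simp_all add: vec_eq_iff transpose_def)
  then show "w \<in> sym_skew_pairs \<Longrightarrow> cmat_pair_scale b w \<in> sym_skew_pairs"
    by (cases w) (simp add: sym_skew_pairs_def cmat_pair_scale_Pair)
qed

lemma Z_cond_scale:
  assumes "b \<noteq> 0" "Z_cond j k lm (v, w)"
  shows "Z_cond j k lm (cmat_pair_scale a v, cmat_pair_scale b w)"
proof (cases lm)
  case None
  have eq: "cf (Cz j k) (v, w) * cf (Cz c d) (v, w) = cf (Cz j d) (v, w) * cf (Cz c k) (v, w)" for c d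
    using assms(2) unfolding Z_cond_def None option.case by blast
  show ?thesis
    unfolding Z_cond_def None option.case cf_scale
  proof (intro allI)
    fix c d
    show "b * cf (Cz j k) (v, w) * (b * cf (Cz c d) (v, w)) = b * cf (Cz j d) (v, w) * (b * cf (Cz c k) (v, w))"
      using eq[of c d] by algebra
  qed
next
  case (Some p)
  obtain l m where lm: "lm = Some (l, m)"
    using Some by (cases p) auto
  let ?x = "(v, w)" and ?y = "(cmat_pair_scale a v, cmat_pair_scale b w)"
  have minor: "minor j k l m ?x \<noteq> 0" and eq: "cf (Cz c d) ?x * minor j k l m ?x
      = cf (Cz j k) ?x * cf (Cz l d) ?x * cf (Cz c m) ?x - cf (Cz j m) ?x * cf (Cz l d) ?x * cf (Cz c k) ?x
        - cf (Cz j d) ?x * cf (Cz l k) ?x * cf (Cz c m) ?x + cf (Cz j d) ?x * cf (Cz l m) ?x * cf (Cz c k) ?x" for c d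
    using assms(2) unfolding Z_cond_def lm option.case prod.case by blast+
  have "cf (Cz c d) ?y * minor j k l m ?y
      = cf (Cz j k) ?y * cf (Cz l d) ?y * cf (Cz c m) ?y - cf (Cz j m) ?y * cf (Cz l d) ?y * cf (Cz c k) ?y
        - cf (Cz j d) ?y * cf (Cz l k) ?y * cf (Cz c m) ?y + cf (Cz j d) ?y * cf (Cz l m) ?y * cf (Cz c k) ?y" for c d
    unfolding cf_scale minor_scale using eq[of c d] by algebra
  moreover have "minor j k l m ?y \<noteq> 0"
    using minor assms(1) by (simp add: minor_scale)
  ultimately show ?thesis
    unfolding Z_cond_def lm option.case prod.case by blast
qed

lemma columns_cond_scale:
  assumes "a \<noteq> 0" "b \<noteq> 0" "columns_cond j sel (v, w)"
  shows "columns_cond j sel (cmat_pair_scale a v, cmat_pair_scale b w)"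
proof -
  let ?x = "(v, w)" and ?y = "(cmat_pair_scale a v, cmat_pair_scale b w)"
  have eq: "(\<Sum>i\<in>UNIV. cf (Ca i n) ?y * zb i n ?y) = a\<^sup>2 * b * (\<Sum>i\<in>UNIV. cf (Ca i n) ?x * zb i n ?x)" for n
    by (simp add: cf_scale zb_scale sum_distrib_left power2_eq_square mult_ac)
  show ?thesis
    unfolding columns_cond_def eq
  proof
    fix n
    have "case sel n of None \<Rightarrow> zb j n ?x = 0
      | Some i \<Rightarrow> zb i n ?x \<noteq> 0 \<and> (\<Sum>i\<in>UNIV. cf (Ca i n) ?x * zb i n ?x) = 0"
      using assms(3) unfolding columns_cond_def by blast
    then show "case sel n of None \<Rightarrow> zb j n ?y = 0
      | Some i \<Rightarrow> zb i n ?y \<noteq> 0 \<and> a\<^sup>2 * b * (\<Sum>i\<in>UNIV. cf (Ca i n) ?x * zb i n ?x) = 0"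
      using assms(1,2) by (cases "sel n") (simp_all add: zb_scale)
  qed
qed

lemma piece_cond_scale:
  assumes "a \<noteq> 0" "b \<noteq> 0" "piece_cond j k lm sel (v, w)"
  shows "piece_cond j k lm sel (cmat_pair_scale a v, cmat_pair_scale b w)"
  using assms by (simp add: piece_cond_def Z_cond_scale columns_cond_scale sym_skew_pairs_scale cf_scale)

text \<open>As \<open>Z\<close> determines \<open>X\<close> and \<open>Y\<close>, it has a nonzero
  entry. Either some two-by-two minor through that entry is nonzero and the rank bound applies, or
  all of them vanish, which is the condition for \<open>None\<close>.\<close>

lemma B_cond_imp_piece_cond:
  assumes Q: "Q \<in> sym_skew_pairs" "Q \<noteq> 0" and B: "B_cond P Q"
  shows "\<exists>j k lm sel. piece_cond j k lm sel (P, Q)"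
proof -
  let ?x = "(P, Q)"
  have "\<exists>j k. cf (Cz j k) ?x \<noteq> 0"
  proof (rule ccontr)
    assume "\<not> ?thesis"
    then have "fst Q $ i $ j = 0" "snd Q $ i $ j = 0" for i j
      using entries_eq_cf(3,4)[of ?x i j] Q(1) by simp_all
    then show False
      using Q(2) by (simp add: prod_eq_iff vec_eq_iff)
  qed
  then obtain j k where jk: "cf (Cz j k) ?x \<noteq> 0"
    by blast
  note cond = B[unfolded B_cond_iff[OF Q(1)]]
  define sel where "sel = (\<lambda>n. if \<exists>i. zb i n ?x \<noteq> 0 then Some (SOME i. zb i n ?x \<noteq> 0) else None)"
  have sel: "columns_cond j sel ?x"
    unfolding columns_cond_def
  proof
    fix n
    show "case sel n of None \<Rightarrow> zb j n ?x = 0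
      | Some i \<Rightarrow> zb i n ?x \<noteq> 0 \<and> (\<Sum>i\<in>UNIV. cf (Ca i n) ?x * zb i n ?x) = 0"
      using cond someI_ex[of "\<lambda>i. zb i n ?x \<noteq> 0"] by (simp add: sel_def)
  qed
  have "\<exists>lm. piece_cond j k lm sel ?x"
  proof (cases "\<exists>l m. minor j k l m ?x \<noteq> 0")
    case True
    then obtain l m where lm: "minor j k l m ?x \<noteq> 0"
      by blast
    then have "piece_cond j k (Some (l, m)) sel ?x"
      using rank_le_2_minors[of "\<chi> i j. cf (Cz i j) ?x" j k l m] cond jk sel Q(1)
      by (simp add: piece_cond_def Z_cond_def minor_def)
    then show ?thesis ..
  next
    case False
    then have "piece_cond j k None sel ?x"
      using jk sel Q(1) by (simp add: piece_cond_def Z_cond_def minor_def)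
    then show ?thesis ..
  qed
  then show ?thesis
    by blast
qed

text \<open>Each equation is linear and homogeneous in the coordinates of the column from which one
  is solved. If all free coordinates vanish, so do first the solved entries of the
  \<open>b\<^sub>n\<close> and then those of the \<open>a\<^sub>n\<close>.\<close>

lemma exists_free_coord:
  assumes "piece_cond j k lm sel (P, Q)" "P \<noteq> 0"
  shows "\<exists>c\<in>AB - range (solved k sel). cf c (P, Q) \<noteq> 0"
proof (rule ccontr)
  let ?x = "(P, Q)"
  assume "\<not> ?thesis"
  then have 0: "cf c ?x = 0" if "c \<in> AB" "c \<notin> range (solved k sel)" for c
    using that by blast
  note sel = piece_cond_sel[OF assms(1)]
  have B1: "cf (Cb i n) ?x = 0" if "i \<noteq> k \<or> sel n \<noteq> None" for i n
    using that by (intro 0) (auto simp: AB_def solved_def split: option.splits)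
  have A1: "cf (Ca i n) ?x = 0" if "sel n \<noteq> Some i" for i n
    using that by (intro 0) (auto simp: AB_def solved_def split: option.splits)
  have B: "cf (Cb i n) ?x = 0" for i n
  proof (cases "i \<noteq> k \<or> sel n \<noteq> None")
    case False
    then have "zb j n ?x = 0"
      using sel[of n] by simp
    then show ?thesis
      using False B1[of _ n] assms(1) by (simp add: zb_def sum.remove[of _ k] piece_cond_def)
  qed (rule B1)
  have A: "cf (Ca i n) ?x = 0" for i n
  proof (cases "sel n = Some i")
    case True
    then show ?thesis
      using sel[of n] A1[of n] by (auto simp: sum.remove[of _ i])
  qed (rule A1)
  have "fst P $ i $ n = 0" "snd P $ i $ n = 0" for i n
    using entries_eq_cf(1,2)[of ?x i n] A B by simp_all
  then show False
    using assms(2) by (simp add: prod_eq_iff vec_eq_iff)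
qed

lemma cone_BB_subset_pieces:
  assumes "(v, w) \<in> BB.cone BB"
  shows "\<exists>a b. a \<noteq> 0 \<and> b \<noteq> 0 \<and> (cmat_pair_scale a v, cmat_pair_scale b w) \<in> (\<Union>idx. piece idx)"
proof -
  obtain P Q where PQ: "module.span cmat_pair_scale {v} = module.span cmat_pair_scale {P}"
    "module.span cmat_pair_scale {w} = module.span cmat_pair_scale {Q}"
    "P \<noteq> 0" "Q \<in> sym_skew_pairs" "Q \<noteq> 0" "B_cond P Q"
    using assms by (auto simp: BB.cone_def BB_def)
  have "P \<in> module.span cmat_pair_scale {v}" "Q \<in> module.span cmat_pair_scale {w}"
    unfolding PQ(1,2) by (simp_all add: BB.V.span_base)
  then obtain a b where ab: "P = cmat_pair_scale a v" "Q = cmat_pair_scale b w"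
    by (auto simp: BB.V.span_singleton)
  then have ab0: "a \<noteq> 0" "b \<noteq> 0"
    using PQ(3,5) by auto
  obtain j k lm sel where pc: "piece_cond j k lm sel (P, Q)"
    using B_cond_imp_piece_cond[OF PQ(4-6)] by blast
  obtain c where c: "c \<in> AB - range (solved k sel)" "cf c (P, Q) \<noteq> 0"
    using exists_free_coord[OF pc PQ(3)] by blast
  have jk: "cf (Cz j k) (P, Q) \<noteq> 0"
    using pc by (simp add: piece_cond_def)
  define a' where "a' = inverse (cf c (P, Q))"
  define b' where "b' = inverse (cf (Cz j k) (P, Q))"
  have ab': "a' \<noteq> 0" "b' \<noteq> 0"
    using c jk by (simp_all add: a'_def b'_def)
  \<comment> \<open>\<open>c\<close> belongs to the first projective factor, so only
    \<open>a'\<close> acts on it.\<close>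
  have "cf c (cmat_pair_scale a' P, cmat_pair_scale b' Q) = a' * cf c (P, Q)"
    using c(1) by (cases c) (auto simp: AB_def cf_scale)
  then have "(cmat_pair_scale a' P, cmat_pair_scale b' Q) \<in> piece ((j, k), lm, sel, c)"
    using piece_cond_scale[OF ab' pc] c jk by (simp add: piece_def cf_scale a'_def b'_def)
  then have "(cmat_pair_scale (a' * a) v, cmat_pair_scale (b' * b) w) \<in> (\<Union>idx. piece idx)"
    unfolding ab BB.V.scale_scale by blast
  then show ?thesis
    using ab0 ab' by (intro exI[of _ "a' * a"] exI[of _ "b' * b"]) simp
qed

lemma chain_in_BB_le:
  assumes "CARD('m::finite) \<ge> 2"
    and "D + CARD('n::finite) + 6 = 2 * CARD('m) * CARD('n) + 4 * CARD('m)"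
    and "\<And>i. i \<le> n \<Longrightarrow> irreducible_closedin (subtopology BB_topology
      (BB :: (((complex^'n^'m) \<times> (complex^'n^'m)) set \<times> ((complex^'m^'m) \<times> (complex^'m^'m)) set) set)) (Z i)"
    and "\<And>i. i < n \<Longrightarrow> Z i \<subset> Z (Suc i)"
  shows "n \<le> D"
proof (rule BB.chain_length_le[of n BB Z, OF assms(3)[unfolded BB_topology_def] assms(4)])
  show "growth_le D {f. complex_poly_fun point_scale f} (\<Union>idx. piece idx :: ('m, 'n) point set)"
    using growth_le_piece[OF assms(1,2)] by (intro growth_le_UN) auto
qed (assumption, assumption, rule cone_BB_subset_pieces)


section \<open>The lower bound\<close>

text \<open>The point with prescribed \<open>U - \<i>V\<close>, \<open>U + \<i>V\<close> and
  \<open>X + \<i>Y\<close>.\<close>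

definition point_of ::
  "('m \<Rightarrow> 'n \<Rightarrow> complex) \<Rightarrow> ('m \<Rightarrow> 'n \<Rightarrow> complex) \<Rightarrow> ('m \<Rightarrow> 'm \<Rightarrow> complex) \<Rightarrow> ('m::finite, 'n::finite) point" where
  "point_of A B Z =
     (((\<chi> i n. (A i n + B i n) / 2), (\<chi> i n. (B i n - A i n) / (2 * \<i>))),
      ((\<chi> i j. (Z i j + Z j i) / 2), (\<chi> i j. (Z i j - Z j i) / (2 * \<i>))))"

lemma cf_point_of:
  "cf (Ca i n) (point_of A B Z) = A i n"
  "cf (Cb i n) (point_of A B Z) = B i n"
  "cf (Cz i j) (point_of A B Z) = Z i j"
  by (simp_all add: point_of_def field_simps)

lemma point_of_sym_skew: "snd (point_of A B Z) \<in> sym_skew_pairs"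
  by (simp add: point_of_def sym_skew_pairs_def transpose_def vec_eq_iff field_simps)

section \<open>Polynomial dependence on the parameter of a line\<close>

definition poly_on_line :: "(complex \<Rightarrow> complex) \<Rightarrow> bool" where
  "poly_on_line g \<longleftrightarrow> (\<exists>r. \<forall>s. g s = poly r s)"

lemma poly_on_line_const: "poly_on_line (\<lambda>s. c)"
  unfolding poly_on_line_def by (intro exI[of _ "[:c:]"]) simp

lemma poly_on_line_add: "poly_on_line g \<Longrightarrow> poly_on_line h \<Longrightarrow> poly_on_line (\<lambda>s. g s + h s)"
  unfolding poly_on_line_def by (metis poly_add)

lemma poly_on_line_diff: "poly_on_line g \<Longrightarrow> poly_on_line h \<Longrightarrow> poly_on_line (\<lambda>s. g s - h s)"
  unfolding poly_on_line_def by (metis poly_diff)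

lemma poly_on_line_mult: "poly_on_line g \<Longrightarrow> poly_on_line h \<Longrightarrow> poly_on_line (\<lambda>s. g s * h s)"
  unfolding poly_on_line_def by (metis poly_mult)

lemma poly_on_line_minus: "poly_on_line g \<Longrightarrow> poly_on_line (\<lambda>s. - g s)"
  unfolding poly_on_line_def by (metis poly_minus)

lemma poly_on_line_divide: "poly_on_line g \<Longrightarrow> poly_on_line (\<lambda>s. g s / c)"
  using poly_on_line_mult[OF _ poly_on_line_const[of "inverse c"]] by (simp add: divide_inverse)

lemma poly_on_line_sum: "(\<And>i. i \<in> I \<Longrightarrow> poly_on_line (g i)) \<Longrightarrow> poly_on_line (\<lambda>s. \<Sum>i\<in>I. g i s)"
  by (induction I rule: infinite_finite_induct) (auto intro: poly_on_line_const poly_on_line_add)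

lemma poly_on_line_if:
  "poly_on_line g \<Longrightarrow> poly_on_line h \<Longrightarrow> poly_on_line (\<lambda>s. if b then g s else h s)"
  by (cases b) auto

lemma poly_on_line_ident: "poly_on_line (\<lambda>s. s)"
  unfolding poly_on_line_def by (intro exI[of _ "[:0, 1:]"]) simp

lemmas poly_on_line_intros = poly_on_line_const poly_on_line_add poly_on_line_diff poly_on_line_mult
  poly_on_line_minus poly_on_line_divide poly_on_line_sum poly_on_line_if poly_on_line_ident

text \<open>\<open>Z = x\<^sub>1 y\<^sub>1\<^sup>T + x\<^sub>2 y\<^sub>2\<^sup>T\<close>, where the rows \<open>p\<close> and \<open>q\<close> of \<open>(x\<^sub>1 x\<^sub>2)\<close> form the identity matrix. The
  equation \<open>(a\<^sup>T x\<^sub>1) (y\<^sub>1\<^sup>T b) + (a\<^sup>T x\<^sub>2) (y\<^sub>2\<^sup>T b) = 0\<close> is satisfied by \<open>a\<^sup>T x\<^sub>1 = \<tau> y\<^sub>2\<^sup>T b\<close> and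
  \<open>a\<^sup>T x\<^sub>2 = - \<tau> y\<^sub>1\<^sup>T b\<close>, which determines the entries \<open>p\<close> and \<open>q\<close> of \<open>a\<close>. A parameter is named
  after the coordinate that detects it; \<open>\<tau>\<close> for the \<open>n\<close>th column is \<open>t (Ca q n)\<close>.\<close>

locale parametrization =
  fixes p q :: "'m::finite" and n0 :: "'n::finite"
  assumes pq: "p \<noteq> q"
begin

definition x1 :: "(('m, 'n) coord \<Rightarrow> complex) \<Rightarrow> 'm \<Rightarrow> complex" where
  "x1 t a = (if a = p then 1 else if a = q then 0 else t (Cz a p))"

definition x2 :: "(('m, 'n) coord \<Rightarrow> complex) \<Rightarrow> 'm \<Rightarrow> complex" where
  "x2 t a = (if a = p then 0 else if a = q then 1 else t (Cz a q))"

text \<open>The fixed entry 1 makes \<open>Z\<close> equal to 1 at \<open>(p, p)\<close>, so the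
  second vector is never zero. The entry 1 in \<open>Bt\<close> does the same for the first
  vector.\<close>

definition y1 :: "(('m, 'n) coord \<Rightarrow> complex) \<Rightarrow> 'm \<Rightarrow> complex" where
  "y1 t b = (if b = p then 1 else t (Cz p b))"

definition y2 :: "(('m, 'n) coord \<Rightarrow> complex) \<Rightarrow> 'm \<Rightarrow> complex" where
  "y2 t b = t (Cz q b)"

definition Zt :: "(('m, 'n) coord \<Rightarrow> complex) \<Rightarrow> 'm \<Rightarrow> 'm \<Rightarrow> complex" where
  "Zt t a b = x1 t a * y1 t b + x2 t a * y2 t b"

definition Bt :: "(('m, 'n) coord \<Rightarrow> complex) \<Rightarrow> 'm \<Rightarrow> 'n \<Rightarrow> complex" where
  "Bt t i n = (if i = p \<and> n = n0 then 1 else t (Cb i n))"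

definition At :: "(('m, 'n) coord \<Rightarrow> complex) \<Rightarrow> 'm \<Rightarrow> 'n \<Rightarrow> complex" where
  "At t i n =
    (if i = p then t (Ca q n) * (\<Sum>b\<in>UNIV. y2 t b * Bt t b n) - (\<Sum>a\<in>UNIV - {p, q}. t (Ca a n) * x1 t a)
     else if i = q then - t (Ca q n) * (\<Sum>b\<in>UNIV. y1 t b * Bt t b n) - (\<Sum>a\<in>UNIV - {p, q}. t (Ca a n) * x2 t a)
     else t (Ca i n))"

definition \<phi> :: "(('m, 'n) coord \<Rightarrow> complex) \<Rightarrow> ('m, 'n) point" where
  "\<phi> t = point_of (At t) (Bt t) (Zt t)"

lemma sum_p_q: "(\<Sum>a\<in>UNIV. f a :: complex) = f p + f q + (\<Sum>a\<in>UNIV - {p, q}. f a)"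
proof -
  have "(\<Sum>a\<in>UNIV. f a) = f p + (\<Sum>a\<in>UNIV - {p}. f a)"
    by (simp add: sum.remove)
  also have "(\<Sum>a\<in>UNIV - {p}. f a) = f q + (\<Sum>a\<in>UNIV - {p} - {q}. f a)"
    using pq by (subst sum.remove[of _ q]) auto
  also have "UNIV - {p} - {q} = UNIV - {p, q}"
    by blast
  finally show ?thesis
    by (simp add: add.assoc)
qed

text \<open>Whatever the parameters, the sums of \<open>a\<^sub>n\<close> against \<open>x1\<close>
  and \<open>x2\<close> collapse to \<tau> \<beta>2 and - \<tau> \<beta>1, and the equation becomes
  \<tau> \<beta>2 \<beta>1 - \<tau> \<beta>1 \<beta>2 = 0.\<close>

lemma equation: "(\<Sum>i\<in>UNIV. cf (Ca i n) (\<phi> t) * zb i n (\<phi> t)) = 0"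
proof -
  define \<beta>1 where "\<beta>1 = (\<Sum>b\<in>UNIV. y1 t b * Bt t b n)"
  define \<beta>2 where "\<beta>2 = (\<Sum>b\<in>UNIV. y2 t b * Bt t b n)"
  have zb: "zb i n (\<phi> t) = x1 t i * \<beta>1 + x2 t i * \<beta>2" for i
    by (simp add: zb_def \<phi>_def cf_point_of Zt_def \<beta>1_def \<beta>2_def sum_distrib_left sum.distrib algebra_simps)
  have S: "(\<Sum>i\<in>UNIV - {p, q}. At t i n * x t i) = (\<Sum>i\<in>UNIV - {p, q}. t (Ca i n) * x t i)"
    for x :: "(('m, 'n) coord \<Rightarrow> complex) \<Rightarrow> 'm \<Rightarrow> complex"
    by (intro sum.cong) (auto simp: At_def)
  have "(\<Sum>i\<in>UNIV. At t i n * x1 t i) = t (Ca q n) * \<beta>2"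
    unfolding sum_p_q S using pq by (simp add: At_def x1_def \<beta>2_def)
  moreover have "(\<Sum>i\<in>UNIV. At t i n * x2 t i) = - t (Ca q n) * \<beta>1"
    unfolding sum_p_q S using pq by (simp add: At_def x2_def \<beta>1_def)
  moreover have "(\<Sum>i\<in>UNIV. cf (Ca i n) (\<phi> t) * zb i n (\<phi> t))
      = (\<Sum>i\<in>UNIV. At t i n * x1 t i) * \<beta>1 + (\<Sum>i\<in>UNIV. At t i n * x2 t i) * \<beta>2"
    unfolding zb by (simp add: \<phi>_def cf_point_of sum_distrib_right sum.distrib distrib_left mult.assoc)
  ultimately show ?thesis
    by simp
qed

lemma rank_le_2: "rank (\<chi> i j. cf (Cz i j) (\<phi> t)) \<le> 2"
proof -
  let ?Y = "{vec_lambda (y1 t), vec_lambda (y2 t)}"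
  have "rows (\<chi> i j. cf (Cz i j) (\<phi> t)) \<subseteq> vec.span ?Y"
  proof
    fix r assume "r \<in> rows (\<chi> i j. cf (Cz i j) (\<phi> t))"
    then obtain i where "r = x1 t i *s vec_lambda (y1 t) + x2 t i *s vec_lambda (y2 t)"
      by (auto simp: rows_def row_def \<phi>_def cf_point_of Zt_def vec_eq_iff)
    then show "r \<in> vec.span ?Y"
      by (simp only:) (intro vec.span_add vec.span_scale vec.span_base; simp)
  qed
  then have "vec.dim (rows (\<chi> i j. cf (Cz i j) (\<phi> t))) \<le> card ?Y"
    by (rule vec.dim_le_card) simp
  also have "\<dots> \<le> 2"
    by (rule card_insert_le_m1) auto
  finally show ?thesis
    by (simp add: row_rank_def_gen)
qed

lemma \<phi>_in_cone: "\<phi> t \<in> BB.cone BB"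
proof -
  obtain P Q where PQ: "\<phi> t = (P, Q)"
    by (cases "\<phi> t")
  have Q: "Q \<in> sym_skew_pairs"
    using point_of_sym_skew[of "At t" "Bt t" "Zt t"] by (simp add: PQ flip: \<phi>_def)
  have "cf (Cb p n0) (\<phi> t) = 1" "cf (Cz p p) (\<phi> t) = 1"
    using pq by (simp_all add: \<phi>_def cf_point_of Bt_def Zt_def x1_def x2_def y1_def)
  then have "P \<noteq> 0" "Q \<noteq> 0"
    by (cases P; cases Q; auto simp: PQ zero_prod_def)+
  moreover have "B_cond P Q"
    using rank_le_2[of t] equation[of _ t] by (simp add: B_cond_iff[OF Q] PQ)
  ultimately show ?thesis
    using Q unfolding PQ BB.cone_def BB_def by blast
qed

lemma poly_on_line_\<phi>:
  assumes "complex_poly_fun point_scale f"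
  shows "poly_on_line (\<lambda>s. f (\<phi> (\<lambda>c. t c + s * (t' c - t c))))"
proof -
  let ?t = "\<lambda>s c. t c + s * (t' c - t c)"
  have A: "poly_on_line (\<lambda>s. At (?t s) i n)" and B: "poly_on_line (\<lambda>s. Bt (?t s) i n)"
    and Z: "poly_on_line (\<lambda>s. Zt (?t s) i j)" for i j n
    unfolding At_def Bt_def Zt_def x1_def x2_def y1_def y2_def by (intro poly_on_line_intros)+
  show ?thesis
    by (rule complex_poly_fun_point_induct[OF assms]; (intro poly_on_line_intros; assumption)?)
      (simp_all add: \<phi>_def point_of_def poly_on_line_intros A B Z)
qed

text \<open>Column \<open>n\<close> of \<open>U - \<i>V\<close> accounts for M - 1 parameters: its M
  - 2 entries outside \<open>p\<close> and \<open>q\<close>, and \<tau> under the name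
  \<open>Ca q n\<close>.\<close>

definition params :: "('m, 'n) coord set" where
  "params = {Ca i n | i n. i \<noteq> p} \<union> ({Cb i n | i n. (i, n) \<noteq> (p, n0)} \<union> Z_params p p q q)"

text \<open>Most parameters are themselves coordinates of the image. The exceptions, in stage 1, are
  \<open>Ca q n\<close> and the \<open>Cz a p\<close>, \<open>Cz a q\<close> with \<open>a\<close>
  outside \<open>{p, q}\<close>. To detect them, \<open>Cb p n\<close> or \<open>Cz q q\<close> of
  stage 0 may have to be on already, while the other \<open>Ca a n\<close>, or \<open>Cz p q\<close>
  and \<open>Cz q p\<close>, all of stage 2, have to be off.\<close>

fun stage :: "('m, 'n) coord \<Rightarrow> nat" where
  "stage (Ca i n) = (if i = q then 1 else 2)"
| "stage (Cb i n) = (if i = p then 0 else 2)"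
| "stage (Cz a b) = (if a = q \<and> b = q then 0 else if a \<in> {p, q} then 2 else 1)"

lemma cf_\<phi>:
  "cf (Ca i n) (\<phi> t) = At t i n" "cf (Cb i n) (\<phi> t) = Bt t i n" "cf (Cz a b) (\<phi> t) = Zt t a b"
  by (simp_all add: \<phi>_def cf_point_of)

lemma cf_\<phi>_eq_0:
  assumes c: "c \<in> params" "t c = 0" and t: "\<And>c'. t c' \<noteq> 0 \<Longrightarrow> stage c' \<le> stage c"
  shows "cf c (\<phi> t) = 0"
proof (cases c)
  case (Ca i n)
  have "t (Ca a n) = 0" if "a \<noteq> q" "i = q" for a
    using t[of "Ca a n"] that by (auto simp: Ca)
  then show ?thesis
    using c pq by (auto simp: Ca cf_\<phi> At_def params_def Z_params_def)
next
  case (Cb i n)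
  then show ?thesis
    using c by (auto simp: cf_\<phi> Bt_def params_def Z_params_def)
next
  case (Cz a b)
  have "t (Cz p q) = 0" "t (Cz q p) = 0" if "a \<noteq> p" "a \<noteq> q"
    using t[of "Cz p q"] t[of "Cz q p"] that pq by (auto simp: Cz)
  then show ?thesis
    using c pq by (auto simp: Cz cf_\<phi> Zt_def x1_def x2_def y1_def y2_def params_def Z_params_def)
qed

lemma exists_cf_\<phi>_neq_0:
  assumes c: "c \<in> params"
  shows "\<exists>t. (\<forall>c'. t c' \<noteq> 0 \<longrightarrow> c' = c \<or> c' \<in> params \<and> stage c' < stage c) \<and> cf c (\<phi> t) \<noteq> 0"
proof -
  define t :: "('m, 'n) coord \<Rightarrow> complex" where
    "t = (\<lambda>c'. if c' = c \<or> c' \<in> params \<and> stage c' < stage c then 1 else 0)"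
  have "cf c (\<phi> t) \<noteq> 0"
  proof (cases c)
    case (Ca i n)
    show ?thesis
    proof (cases "i = q")
      case True
      have "t (Ca a n) = 0" if "a \<noteq> q" for a
        using that by (simp add: t_def Ca True)
      \<comment> \<open>The entries of \<open>y1\<close> other than \<open>p\<close> are of stage 2
        and still off, so the sum is 1 and the coordinate equals -1.\<close>
      moreover have "y1 t b * Bt t b n = (if b = p then 1 else 0)" for b
        using pq by (auto simp: y1_def Bt_def t_def Ca True params_def)
      moreover have "t (Ca q n) = 1"
        by (simp add: t_def Ca True)
      ultimately show ?thesis
        using pq by (simp add: Ca True cf_\<phi> At_def)
    next
      case False
      then show ?thesis
        using c by (auto simp: Ca cf_\<phi> At_def params_def Z_params_def t_def)
    qed
  next
    case (Cb i n)
    then show ?thesis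
      using c by (auto simp: cf_\<phi> Bt_def params_def Z_params_def t_def)
  next
    case (Cz a b)
    have "t (Cz p q) = 0" "t (Cz q p) = 0" "t (Cz q q) = 1" if "a \<noteq> p" "a \<noteq> q"
      using that pq by (auto simp: Cz t_def params_def Z_params_def)
    moreover have "t (Cz a b) = 1"
      by (simp add: Cz t_def)
    ultimately show ?thesis
      using c pq by (auto simp: Cz cf_\<phi> Zt_def x1_def x2_def y1_def y2_def params_def Z_params_def)
  qed
  then show ?thesis
    by (intro exI[of _ t]) (simp add: t_def)
qed

text \<open>The three kinds of parameters contribute MN - N, MN - 1 and 4M - 5.\<close>

lemma card_params: "card params + CARD('n) + 6 = 2 * CARD('m) * CARD('n) + 4 * CARD('m)"
proof -
  let ?A = "{Ca i n | i n. i \<noteq> p} :: ('m, 'n) coord set"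
  let ?B = "{Cb i n | i n. (i, n) \<noteq> (p, n0)} :: ('m, 'n) coord set"
  have "?A = (\<lambda>(i, n). Ca i n) ` ((UNIV - {p}) \<times> UNIV)"
    by auto
  then have "card ?A = card ((UNIV - {p}) \<times> (UNIV :: 'n set))"
    by (simp only:) (intro card_image, auto simp: inj_on_def)
  also have "\<dots> = CARD('m) * CARD('n) - CARD('n)"
    by (simp add: card_cartesian_product card_Diff_singleton diff_mult_distrib)
  finally have A: "card ?A + CARD('n) = CARD('m) * CARD('n)"
    by simp
  have "?B = (\<lambda>(i, n). Cb i n) ` (UNIV - {(p, n0)})"
    by auto
  then have "card ?B = card (UNIV - {(p, n0)} :: ('m \<times> 'n) set)"
    by (simp only:) (intro card_image, auto simp: inj_on_def)
  then have B: "card ?B + 1 = CARD('m) * CARD('n)"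
    using card_Suc_Diff1[of "UNIV :: ('m \<times> 'n) set" "(p, n0)"] by simp
  have "card params = card ?A + card (?B \<union> Z_params p p q q)"
    unfolding params_def by (rule card_Un_disjoint) (auto simp: Z_params_def)
  also have "card (?B \<union> Z_params p p q q) = card ?B + card (Z_params p p q q :: ('m, 'n) coord set)"
    by (rule card_Un_disjoint) (auto simp: Z_params_def)
  finally show ?thesis
    using A B card_Z_params[OF pq pq, where 'n = 'n] by simp
qed

lemma exists_chain:
  "\<exists>Z. (\<forall>i\<le>card params. irreducible_closedin (subtopology BB_topology
      (BB :: (((complex^'n^'m) \<times> (complex^'n^'m)) set \<times> ((complex^'m^'m) \<times> (complex^'m^'m)) set) set)) (Z i)) \<and>
    (\<forall>i<card params. Z i \<subset> Z (Suc i))"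
  unfolding BB_topology_def
proof (rule BB.chain_of_parametrization[where x = cf and st = stage and \<phi> = \<phi>])
  show "\<exists>r. \<forall>s. f (\<phi> (\<lambda>c. t c + s * (t' c - t c))) = poly r s"
    if "complex_poly_fun point_scale f" for f t t'
    using poly_on_line_\<phi>[OF that] unfolding poly_on_line_def .
qed (simp_all add: \<phi>_in_cone bihomogeneous_cf cf_\<phi>_eq_0 exists_cf_\<phi>_neq_0)

end


section \<open>The dimension\<close>

theorem theorem3p4:
  assumes "CARD('m::finite) \<ge> 2"
  shows "krull_dim (subtopology BB_topology
           (BB :: (((complex^'n::finite^'m) \<times> (complex^'n^'m)) set
                   \<times> ((complex^'m^'m) \<times> (complex^'m^'m)) set) set))
         = ereal (2 * real CARD('m) * real CARD('n) - real CARD('n) + 4 * real CARD('m) - 6)"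
proof -
  obtain p q :: 'm where "p \<noteq> q"
    using assms card_le_Suc0_iff_eq[of "UNIV :: 'm set"] by fastforce
  then interpret parametrization p q "undefined :: 'n"
    by unfold_locales
  define D where "D = card params"
  have D: "D + CARD('n) + 6 = 2 * CARD('m) * CARD('n) + 4 * CARD('m)"
    unfolding D_def by (rule card_params)
  \<comment> \<open>\<open>D\<close> is characterised additively, so that no truncated subtraction
    of natural numbers occurs before this passage to the reals.\<close>
  have "real D = real (2 * CARD('m) * CARD('n) + 4 * CARD('m)) - real CARD('n) - 6"
    unfolding D[symmetric] by simp
  then have "2 * real CARD('m) * real CARD('n) - real CARD('n) + 4 * real CARD('m) - 6 = real D"
    by simp
  moreover have "krull_dim (subtopology BB_topology
      (BB :: (((complex^'n^'m) \<times> (complex^'n^'m)) set \<times> ((complex^'m^'m) \<times> (complex^'m^'m)) set) set))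
      = ereal (real D)"
    unfolding krull_dim_def
  proof (rule antisym)
    show "Sup {ereal (real n) | n. \<exists>Z. (\<forall>i\<le>n. irreducible_closedin (subtopology BB_topology
        (BB :: (((complex^'n^'m) \<times> (complex^'n^'m)) set \<times> ((complex^'m^'m) \<times> (complex^'m^'m)) set) set)) (Z i)) \<and>
        (\<forall>i<n. Z i \<subset> Z (Suc i))} \<le> ereal (real D)"
      using chain_in_BB_le[OF assms D] by (intro Sup_least) fastforce
    show "ereal (real D) \<le> Sup {ereal (real n) | n. \<exists>Z. (\<forall>i\<le>n. irreducible_closedin (subtopology BB_topology
        (BB :: (((complex^'n^'m) \<times> (complex^'n^'m)) set \<times> ((complex^'m^'m) \<times> (complex^'m^'m)) set) set)) (Z i)) \<and>
        (\<forall>i<n. Z i \<subset> Z (Suc i))}"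
      using exists_chain unfolding D_def by (intro Sup_upper) blast
  qed
  ultimately show ?thesis
    by simp
qed

end
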